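(* Let $r\in|\Omega_a|_p$ with $p^{-\frac{1}{p^{a-1}(p-1)}}<r<1$ and let $s\in p^{\mathbb{Z}_{\ge0}}$. Then $U_p\,\mathcal{H}(\mathbf{A}_{r,s})\subseteq\mathcal{H}(\mathbf{A}_{r^p,sp})$. Moreover $U_q=U_p^a$ and $U_q\,\mathcal{H}(\mathbf{A}_r)\subseteq\mathcal{H}(\mathbf{A}_{r^q})$.
   Context: $p$ prime, $a\ge1$, $q=p^a$, $\mathbb{Z}_q$ the ring of integers of the degree-$a$ unramified extension of $\mathbb{Q}_p$. $\Omega_1=\mathbb{Q}_p(\zeta_p)$, $\Omega_a$ its unramified extension of degree $a$, $|\cdot|_p$ with $|p|_p=p^{-1}$, $|\Omega_a|_p$ its value group. $\ell\ge1$; $\hat P_1=\infty$; if $\ell\ge2$, $\hat P_2=0$ and $\hat P_3,\dots,\hat P_\ell\in\mathbb{Z}_q$ are Teichmüller lifts of pairwise distinct nonzero elements of $\mathbb{F}_q$. For $0<r<1$ in $|\Omega_a|_p$ and $s$ a power of $p$ (including $1$), $\mathbf{A}_{r,s}=\{X\in\Omega_a:|X|_p\le1/r,\ |X-\hat P_j^s|_p\ge r\ (2\le j\le\ell)\}$, $\mathbf{A}_r=\mathbf{A}_{r,1}$, and $\mathcal{H}(\cdot)$ is the Banach algebra of rigid analytic functions over $\Omega_a$ on the affinoid (supremum norm). $U_p$ is defined by $(U_p\xi)(X)=\frac1p\sum_{Z^p=X}\xi(Z)$, and $U_q$ by $(U_q\xi)(X)=\frac1q\sum_{Z^q=X}\xi(Z)$.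 *)

theory Defs
  imports "HOL-Analysis.Analysis" "HOL-Algebra.Algebraic_Closure_Type"
    "HOL-Algebra.Generated_Fields"
begin

text \<open>
  The absolute value is a parameter of its own, since the library's \<open>norm\<close> is confined to
  real normed vector spaces.
\<close>

class nonarch_field = alg_closed_field + field_char_0 + complete_space +
  fixes absv :: "'a \<Rightarrow> real"
  assumes dist_absv: "dist x y = absv (x - y)"
    and absv_mult: "absv (x * y) = absv x * absv y"
    and absv_ultrametric: "absv (x + y) \<le> max (absv x) (absv y)"

text \<open>
  If \<open>absv\<close> extends the \<open>p\<close>-adic absolute value of the rationals, the closure of the
  rationals in the complete field \<open>'k\<close> is the field of \<open>p\<close>-adic numbers.
\<close>

definition Qp :: "'k::nonarch_field set" where
  "Qp = closure \<rat>"

text \<open>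
  \<open>'k\<close> is the completion of an algebraic closure of the \<open>p\<close>-adic numbers, which
  determines it up to isometric isomorphism.  All \<open>p\<close>-adic fields below are subfields of it.
\<close>

definition is_Cp :: "nat \<Rightarrow> 'k::nonarch_field itself \<Rightarrow> bool" where
  "is_Cp p _ \<longleftrightarrow> absv (of_nat p :: 'k) = 1 / real p \<and>
     closure {x :: 'k. \<exists>f. f \<noteq> 0 \<and> (\<forall>i. Polynomial.coeff f i \<in> Qp) \<and> poly f x = 0} = UNIV"

abbreviation field_ring :: "'k::nonarch_field ring" where
  "field_ring \<equiv> ring_of_type_algebra"

definition valuation_ring :: "'k::nonarch_field set \<Rightarrow> 'k set" where
  "valuation_ring L = {x \<in> L. absv x \<le> 1}"

definition valuation_ideal :: "'k::nonarch_field set \<Rightarrow> 'k set" where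
  "valuation_ideal L = {x \<in> L. absv x < 1}"

definition residue_field :: "'k::nonarch_field set \<Rightarrow> 'k set ring" where
  "residue_field L = (field_ring\<lparr>carrier := valuation_ring L\<rparr>) Quot (valuation_ideal L)"

text \<open>The image in the residue field of \<open>L\<close> of the residue field of a subfield \<open>K\<close>:\<close>

definition residue_subfield :: "'k::nonarch_field set \<Rightarrow> 'k set \<Rightarrow> 'k set set" where
  "residue_subfield K L =
     (\<lambda>x. valuation_ideal L +>\<^bsub>field_ring\<lparr>carrier := valuation_ring L\<rparr>\<^esub> x) ` valuation_ring K"

text \<open>
  An extension of degree \<open>n\<close> is unramified if the residue extension is separable, also of
  degree \<open>n\<close>.  Separability is automatic here and left out: this is only used over finite
  extensions of \<open>Qp\<close>, whose residue fields are finite, hence perfect.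
\<close>

definition unramified_extension :: "'k::nonarch_field set \<Rightarrow> 'k set \<Rightarrow> nat \<Rightarrow> bool" where
  "unramified_extension K L n \<longleftrightarrow>
     subfield K field_ring \<and> subfield L field_ring \<and> K \<subseteq> L \<and>
     ring.dimension field_ring n K L \<and>
     ring.dimension (residue_field L) n (residue_subfield K L) (carrier (residue_field L))"

text \<open>\<open>Qp\<close> with the primitive \<open>p\<close>-th roots of unity adjoined; each of them generates the same field.\<close>

definition Omega1 :: "nat \<Rightarrow> 'k::nonarch_field set" where
  "Omega1 p = generate_field field_ring (Qp \<union> {\<zeta>. \<zeta> ^ p = 1 \<and> \<zeta> \<noteq> 1})"

text \<open>The Teichmueller lift of a class \<open>C\<close> of a residue field with \<open>q\<close> elements:\<close>

definition teichmueller_lift :: "nat \<Rightarrow> 'k::nonarch_field set \<Rightarrow> 'k \<Rightarrow> bool" where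
  "teichmueller_lift q C t \<longleftrightarrow> t \<in> C \<and> t ^ q = t"

text \<open>
  The geometric points of the affinoid.  A function defined over a subfield \<open>K\<close> is evaluated at
  all of these and not only at those in \<open>K\<close>, since \<open>z\<close> with \<open>z ^ p = x\<close> need not lie in \<open>K\<close> when
  \<open>x\<close> does.  The bound \<open>absv x \<le> 1 / r\<close> removes the disc around the first point, infinity;
  \<open>P 1\<close> is never used.
\<close>

definition affinoid :: "nat \<Rightarrow> (nat \<Rightarrow> 'k::nonarch_field) \<Rightarrow> real \<Rightarrow> nat \<Rightarrow> 'k set" where
  "affinoid l P r s = {x. absv x \<le> 1 / r \<and> (\<forall>j\<in>{2..l}. absv (x - P j ^ s) \<ge> r)}"

text \<open>
  The Tate algebra over \<open>K\<close> in the variables \<open>T 1, \<dots>, T l\<close>: families of coefficients in \<open>K\<close>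
  tending to \<open>0\<close>.
\<close>

definition multi_indices :: "nat \<Rightarrow> (nat \<Rightarrow> nat) set" where
  "multi_indices l = {1..l} \<rightarrow>\<^sub>E UNIV"

definition tate_algebra :: "'k::nonarch_field set \<Rightarrow> nat \<Rightarrow> ((nat \<Rightarrow> nat) \<Rightarrow> 'k) set" where
  "tate_algebra K l = {c. (\<forall>\<nu>\<in>multi_indices l. c \<nu> \<in> K) \<and>
     (\<forall>\<epsilon>>0. finite {\<nu>\<in>multi_indices l. absv (c \<nu>) \<ge> \<epsilon>})}"

text \<open>
  With \<open>absv \<rho> = r\<close>, the affinoid is cut out by \<open>absv (\<rho> * x) \<le> 1\<close> and
  \<open>absv (\<rho> / (x - P j ^ s)) \<le> 1\<close>; its affinoid algebra is the Tate algebra modulo the ideal of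
  \<open>(x - P j ^ s) * T j - \<rho>\<close>, \<open>2 \<le> j \<le> l\<close>, where \<open>x = T 1 / \<rho>\<close>.
\<close>

definition affinoid_coord ::
    "(nat \<Rightarrow> 'k::nonarch_field) \<Rightarrow> 'k \<Rightarrow> nat \<Rightarrow> 'k \<Rightarrow> nat \<Rightarrow> 'k" where
  "affinoid_coord P \<rho> s x j = (if j = 1 then \<rho> * x else \<rho> / (x - P j ^ s))"

text \<open>
  The rigid analytic functions over \<open>K\<close> on the affinoid.  The affinoid algebra is reduced, so its
  elements are functions on the geometric points.  They are represented by total functions, of
  which only the values on the affinoid matter.
\<close>

definition rigid_functions ::
    "'k::nonarch_field set \<Rightarrow> nat \<Rightarrow> (nat \<Rightarrow> 'k) \<Rightarrow> real \<Rightarrow> nat \<Rightarrow> ('k \<Rightarrow> 'k) set" where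
  "rigid_functions K l P r s = {\<xi>. \<exists>\<rho>\<in>K. absv \<rho> = r \<and> (\<exists>c\<in>tate_algebra K l.
     \<forall>x\<in>affinoid l P r s.
       ((\<lambda>\<nu>. c \<nu> * (\<Prod>j\<in>{1..l}. affinoid_coord P \<rho> s x j ^ \<nu> j)) has_sum \<xi> x) (multi_indices l))}"

text \<open>
  The sum over the solutions of \<open>z ^ n = x\<close> counts multiplicities.  They matter only for \<open>x = 0\<close>,
  where \<open>z = 0\<close> has multiplicity \<open>n\<close>; \<open>0\<close> lies in the affinoid only if \<open>l = 1\<close>.
\<close>

definition U_op :: "nat \<Rightarrow> ('k::nonarch_field \<Rightarrow> 'k) \<Rightarrow> 'k \<Rightarrow> 'k" where
  "U_op n \<xi> x = (\<Sum>z\<in>#proots (Polynomial.monom 1 n - [:x:]). \<xi> z) / of_nat n"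

end

theory Submission
  imports Defs
begin

text \<open>
  Let \<open>z ^ p = x\<close>, let \<open>w j\<close> be the affinoid coordinates of \<open>z\<close> for the radius \<open>r\<close> and \<open>y j\<close> those
  of \<open>x\<close> for the radius \<open>r ^ p\<close>.  Expanding \<open>z ^ p\<close> around the centre of the \<open>j\<close>-th disc gives a monic
  equation of degree \<open>p\<close> for \<open>w j\<close> over the polynomials in \<open>y j\<close>, whose coefficients are integral
  because \<open>r ^ (p - 1) > 1 / p\<close>.  So \<open>U_p\<close> of an arbitrary monomial in the \<open>w j\<close> is an integral
  combination of polynomials in the \<open>y j\<close> times \<open>U_p\<close> of the finitely many monomials with exponents
  below \<open>p\<close>.  As \<open>w j\<close> is also a polynomial in \<open>z\<close> and \<open>y j\<close>, these finitely many values are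
  polynomials in the \<open>y j\<close> over \<open>\<Omega>\<close>.  Hence \<open>U_p\<close> maps all monomials to polynomials in the \<open>y j\<close> with one
  common denominator, and a series with null coefficients can be rearranged, \<open>\<Omega>\<close> being complete.

  The centres lie in \<open>\<Omega>\<close>: the residue field of \<open>\<Omega>\<close> has exactly \<open>q\<close> elements, since \<open>Omega1 p\<close>
  is totally ramified over \<open>Qp\<close>, and every residue class contains a fixed point of \<open>t \<mapsto> t ^ q\<close>, the
  limit of \<open>x ^ q ^ n\<close> for any \<open>x\<close> in the class.  These are all the fixed points there are.

  Iterating \<open>a\<close> times turns the exponent \<open>1\<close> into \<open>q\<close>, which does not move the centres.
\<close>

section \<open>The topology of a nonarchimedean field\<close>

lemma absv_0 [simp]: "absv (0::'k::nonarch_field) = 0"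
  using dist_absv[of "0::'k" 0] by simp

lemma absv_nonneg [simp]: "absv (x::'k::nonarch_field) \<ge> 0"
  using dist_absv[of x 0] by (metis diff_zero zero_le_dist)

lemma absv_eq_0_iff [simp]: "absv (x::'k::nonarch_field) = 0 \<longleftrightarrow> x = 0"
  using dist_absv[of x 0] by (metis diff_zero dist_eq_0_iff)

lemma absv_pos_iff [simp]: "absv (x::'k::nonarch_field) > 0 \<longleftrightarrow> x \<noteq> 0"
  using absv_nonneg[of x] absv_eq_0_iff[of x] by linarith

lemma absv_1 [simp]: "absv (1::'k::nonarch_field) = 1"
  using absv_mult[of "1::'k" 1] absv_eq_0_iff[of "1::'k"] by simp

lemma absv_minus [simp]: "absv (- x) = absv (x::'k::nonarch_field)"
  using dist_absv[of 0 x] dist_absv[of x 0] by (simp add: dist_commute)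

lemma absv_minus_commute: "absv (x - y) = absv (y - x::'k::nonarch_field)"
  using absv_minus[of "x - y"] by simp

lemma absv_power [simp]: "absv (x ^ n) = absv (x::'k::nonarch_field) ^ n"
  by (induction n) (auto simp: absv_mult)

lemma absv_prod: "absv (\<Prod>i\<in>A. f i) = (\<Prod>i\<in>A. absv (f i :: 'k::nonarch_field))"
  by (induction A rule: infinite_finite_induct) (auto simp: absv_mult)

lemma absv_inverse [simp]: "absv (inverse x) = inverse (absv (x::'k::nonarch_field))"
proof (cases "x = 0")
  case False
  then have "absv x * absv (inverse x) = 1"
    by (simp flip: absv_mult)
  then show ?thesis
    by (metis inverse_unique)
qed simp

lemma absv_divide [simp]: "absv (x / y) = absv x / absv (y::'k::nonarch_field)"
  by (simp add: divide_inverse absv_mult)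

lemma absv_add_le:
  "absv x \<le> b \<Longrightarrow> absv y \<le> b \<Longrightarrow> absv (x + y :: 'k::nonarch_field) \<le> b"
  using absv_ultrametric[of x y] by simp

lemma absv_diff_le:
  "absv x \<le> b \<Longrightarrow> absv y \<le> b \<Longrightarrow> absv (x - y :: 'k::nonarch_field) \<le> b"
  using absv_add_le[of x b "- y"] by simp

lemma absv_add_less:
  "absv x < b \<Longrightarrow> absv y < b \<Longrightarrow> absv (x + y :: 'k::nonarch_field) < b"
  using absv_ultrametric[of x y] by simp

lemma absv_diff_less:
  "absv x < b \<Longrightarrow> absv y < b \<Longrightarrow> absv (x - y :: 'k::nonarch_field) < b"
  using absv_add_less[of x b "- y"] by simp

text \<open>In \<open>x = (x + y) - y\<close> the summand \<open>y\<close> is too small to account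
  for \<open>absv x\<close>, so \<open>x + y\<close> must be as large as \<open>x\<close>.\<close>

lemma absv_add_eq:
  assumes "absv y < absv (x::'k::nonarch_field)"
  shows "absv (x + y) = absv x"
  using absv_ultrametric[of x y] absv_ultrametric[of "x + y" "- y"] assms by simp

lemma absv_sum_le:
  fixes f :: "'i \<Rightarrow> 'k::nonarch_field"
  assumes "\<And>i. i \<in> A \<Longrightarrow> absv (f i) \<le> b" and "b \<ge> 0"
  shows "absv (sum f A) \<le> b"
  using assms by (induction A rule: infinite_finite_induct) (auto intro: absv_add_le)

lemma absv_of_nat_le_1 [simp]: "absv (of_nat n :: 'k::nonarch_field) \<le> 1"
  by (induction n) (auto intro: absv_add_le)

lemma absv_of_int_le_1 [simp]: "absv (of_int n :: 'k::nonarch_field) \<le> 1"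
  by (cases n rule: int_cases2) simp_all

section \<open>Continuity of the field operations\<close>

instance nonarch_field \<subseteq> topological_ab_group_add
proof
  fix a b :: 'a
  show "((\<lambda>x. fst x + snd x) \<longlongrightarrow> a + b) (nhds a \<times>\<^sub>F nhds b)"
    unfolding tendsto_iff
  proof safe
    fix e :: real
    assume e: "e > 0"
    have *: "absv (x + y - (a + b)) < e" if "absv (x - a) < e" "absv (y - b) < e" for x y
      using absv_add_less[OF that] by (simp add: algebra_simps)
    have "\<forall>\<^sub>F x in nhds a. dist x a < e" "\<forall>\<^sub>F y in nhds b. dist y b < e"
      using e by (auto intro: eventually_nhds_metric[THEN iffD2])
    then have "\<forall>\<^sub>F xy in nhds a \<times>\<^sub>F nhds b. dist (fst xy) a < e \<and> dist (snd xy) b < e"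
      by (auto simp: eventually_prod_filter)
    then show "\<forall>\<^sub>F xy in nhds a \<times>\<^sub>F nhds b. dist (fst xy + snd xy) (a + b) < e"
      by eventually_elim (use * in \<open>auto simp: dist_absv\<close>)
  qed
  show "(uminus \<longlongrightarrow> - a) (nhds a)"
    unfolding tendsto_iff
  proof safe
    fix e :: real
    assume "e > 0"
    then have "\<forall>\<^sub>F x in nhds a. dist x a < e"
      by (auto intro: eventually_nhds_metric[THEN iffD2])
    then show "\<forall>\<^sub>F x in nhds a. dist (- x) (- a) < e"
      by eventually_elim (simp add: dist_absv absv_minus_commute)
  qed
qed

lemma tendsto_absv_diff_0:
  "(f \<longlongrightarrow> l) F \<longleftrightarrow> ((\<lambda>x. absv (f x - l :: 'k::nonarch_field)) \<longlongrightarrow> 0) F"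
  using tendsto_dist_iff[of f l F] by (simp add: dist_absv)

lemma tendsto_absv:
  assumes "(f \<longlongrightarrow> (l::'k::nonarch_field)) F"
  shows "((\<lambda>x. absv (f x)) \<longlongrightarrow> absv l) F"
  using tendsto_dist[OF assms tendsto_const[of 0]] by (simp add: dist_absv)

instance nonarch_field \<subseteq> topological_semigroup_mult
proof
  fix a b :: 'a
  let ?F = "nhds a \<times>\<^sub>F nhds b"
  have f: "filterlim fst (nhds a) ?F" and s: "filterlim snd (nhds b) ?F"
    by (rule filterlim_fst filterlim_snd)+
  have 1: "((\<lambda>x. absv (fst x - a)) \<longlongrightarrow> 0) ?F" and 2: "((\<lambda>x. absv (snd x - b)) \<longlongrightarrow> 0) ?F"
    using f s by (simp_all flip: tendsto_absv_diff_0)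
  have 3: "((\<lambda>x. absv (fst x - a) * absv (snd x) + absv a * absv (snd x - b)) \<longlongrightarrow> 0) ?F"
    using 1 2 tendsto_absv[OF s] by (auto intro!: tendsto_eq_intros)
  have "((\<lambda>x. absv (fst x * snd x - a * b)) \<longlongrightarrow> 0) ?F"
  proof (rule tendsto_sandwich[OF _ _ tendsto_const 3])
    \<comment> \<open>The difference is \<open>(x - a) * y + a * (y - b)\<close>; the ultrametric
      maximum is then weakened to a sum, whose limit is easy to compute.\<close>
    have "absv (x * y - a * b) \<le> absv (x - a) * absv y + absv a * absv (y - b)" for x y
      using absv_ultrametric[of "(x - a) * y" "a * (y - b)"]
      by (simp add: algebra_simps absv_mult max_def split: if_splits)
        (smt (verit) absv_nonneg absv_mult algebra_simps)+
    then show "\<forall>\<^sub>F x in ?F. absv (fst x * snd x - a * b)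
        \<le> absv (fst x - a) * absv (snd x) + absv a * absv (snd x - b)"
      by simp
  qed simp
  then show "((\<lambda>x. fst x * snd x) \<longlongrightarrow> a * b) ?F"
    by (simp flip: tendsto_absv_diff_0)
qed

lemma tendsto_inverse_nonarch:
  assumes "(f \<longlongrightarrow> (l::'k::nonarch_field)) F" and "l \<noteq> 0"
  shows "((\<lambda>x. inverse (f x)) \<longlongrightarrow> inverse l) F"
proof -
  have "\<forall>\<^sub>F x in F. f x \<noteq> 0"
    using assms tendsto_imp_eventually_ne by blast
  moreover have "absv (y - l) * inverse (absv l) * inverse (absv y) = absv (inverse y - inverse l)"
    if "y \<noteq> 0" for y
  proof -
    have "inverse y - inverse l = (l - y) * inverse l * inverse y"
      using that \<open>l \<noteq> 0\<close> by (simp add: field_simps)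
    then show ?thesis
      by (simp add: absv_mult absv_minus_commute)
  qed
  ultimately have "\<forall>\<^sub>F x in F. absv (f x - l) * inverse (absv l) * inverse (absv (f x))
      = absv (inverse (f x) - inverse l)"
    by (rule eventually_mono)
  moreover have "((\<lambda>x. absv (f x - l) * inverse (absv l) * inverse (absv (f x))) \<longlongrightarrow> 0) F"
    using assms tendsto_absv[OF assms(1)]
    by (auto intro!: tendsto_eq_intros simp: tendsto_absv_diff_0)
  ultimately have "((\<lambda>x. absv (inverse (f x) - inverse l)) \<longlongrightarrow> 0) F"
    by (rule Lim_transform_eventually[rotated])
  then show ?thesis
    by (simp only: tendsto_absv_diff_0[of "\<lambda>x. inverse (f x)"])
qed

section \<open>Completeness and sums of null families\<close>

lemma Cauchy_absvI:
  assumes "\<And>e. e > 0 \<Longrightarrow> \<exists>M. \<forall>m\<ge>M. \<forall>n\<ge>M. absv (u m - u n :: 'k::nonarch_field) < e"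
  shows "Cauchy u"
  using assms by (auto simp: Cauchy_def dist_absv)

text \<open>A finite partial sum over a superset \<open>Y\<close> of \<open>F\<close> differs from
  \<open>sum f F\<close> by terms outside \<open>F\<close>; the ultrametric bound on their sum does
  not depend on \<open>Y\<close> and passes to the limit.\<close>

lemma absv_has_sum_tail_le:
  fixes f :: "'i \<Rightarrow> 'k::nonarch_field"
  assumes S: "(f has_sum S) A" and F: "finite F" "F \<subseteq> A"
    and le: "\<And>i. i \<in> A - F \<Longrightarrow> absv (f i) \<le> b" and b: "b \<ge> 0"
  shows "absv (S - sum f F) \<le> b"
proof -
  have lim: "((\<lambda>Y. absv (sum f Y - sum f F)) \<longlongrightarrow> absv (S - sum f F)) (finite_subsets_at_top A)"
    using S unfolding has_sum_def by (intro tendsto_absv tendsto_intros)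
  have "\<forall>\<^sub>F Y in finite_subsets_at_top A. absv (sum f Y - sum f F) \<le> b"
    unfolding eventually_finite_subsets_at_top
  proof (intro exI[of _ F] conjI allI impI)
    fix Y
    assume Y: "finite Y \<and> F \<subseteq> Y \<and> Y \<subseteq> A"
    then have "sum f Y - sum f F = sum f (Y - F)"
      using F by (metis sum_diff)
    also have "absv \<dots> \<le> b"
      using Y le b by (intro absv_sum_le) auto
    finally show "absv (sum f Y - sum f F) \<le> b" .
  qed (use F in auto)
  then show ?thesis
    by (intro tendsto_upperbound[OF lim]) auto
qed

lemma nonarch_has_sumI:
  fixes f :: "'i \<Rightarrow> 'k::nonarch_field"
  assumes "\<And>e. e > 0 \<Longrightarrow> \<exists>F. finite F \<and> F \<subseteq> A \<and>
             (\<forall>Y. finite Y \<and> F \<subseteq> Y \<and> Y \<subseteq> A \<longrightarrow> absv (sum f Y - S) < e)"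
  shows "(f has_sum S) A"
  unfolding has_sum_def tendsto_iff eventually_finite_subsets_at_top dist_absv
  using assms by meson

text \<open>In a complete ultrametric field a null family is summable: the sums over the finite sets
  of terms of size at least \<open>1 / (n + 1)\<close> form a Cauchy sequence, and all further terms
  change them by at most that amount.\<close>

lemma nonarch_summable:
  fixes f :: "'i \<Rightarrow> 'k::nonarch_field"
  assumes fin: "\<And>e. e > 0 \<Longrightarrow> finite {i \<in> A. absv (f i) \<ge> e}"
  shows "\<exists>S. (f has_sum S) A"
proof -
  define F where "F n = {i \<in> A. absv (f i) \<ge> inverse (real (Suc n))}" for n
  have F: "finite (F n)" "F n \<subseteq> A" for n
    using fin by (auto simp: F_def)
  have close: "absv (sum f Y - sum f (F n)) \<le> inverse (real (Suc n))"
    if "finite Y" "F n \<subseteq> Y" "Y \<subseteq> A" for Y n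
  proof -
    have "sum f Y - sum f (F n) = sum f (Y - F n)"
      using that F by (metis sum_diff)
    also have "absv \<dots> \<le> inverse (real (Suc n))"
      using that by (intro absv_sum_le) (auto simp: F_def not_le intro: less_imp_le)
    finally show ?thesis .
  qed
  have mono: "F m \<subseteq> F n" if "m \<le> n" for m n
  proof -
    have "inverse (real (Suc n)) \<le> inverse (real (Suc m))"
      using that by (simp add: field_simps)
    then show ?thesis
      unfolding F_def using order_trans by blast
  qed
  have cl: "absv (sum f (F n) - sum f (F m)) \<le> inverse (real (Suc m))" if "m \<le> n" for m n
    using close[of "F n" m] F mono[OF that] by simp
  have "Cauchy (\<lambda>n. sum f (F n))"
  proof (rule Cauchy_absvI)
    fix e :: real
    assume "e > 0"
    then obtain M where M: "inverse (real (Suc M)) < e"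
      using reals_Archimedean by blast
    have "absv (sum f (F m) - sum f (F n)) < e" if "m \<ge> M" "n \<ge> M" for m n
      using absv_diff_le[OF cl[OF that(1)] cl[OF that(2)]] M by simp
    then show "\<exists>M. \<forall>m\<ge>M. \<forall>n\<ge>M. absv (sum f (F m) - sum f (F n)) < e"
      by blast
  qed
  then obtain S where S: "(\<lambda>n. sum f (F n)) \<longlonglongrightarrow> S"
    using Cauchy_convergent convergent_def by blast
  show ?thesis
  proof (intro exI[of _ S] nonarch_has_sumI)
    fix e :: real
    assume "e > 0"
    then have "\<forall>\<^sub>F n in sequentially. inverse (real (Suc n)) < e"
      using LIMSEQ_inverse_real_of_nat by (auto simp: order_tendsto_iff)
    moreover have "\<forall>\<^sub>F n in sequentially. absv (sum f (F n) - S) < e"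
      using S \<open>e > 0\<close> by (auto simp: tendsto_iff dist_absv)
    ultimately have "\<forall>\<^sub>F n in sequentially. inverse (real (Suc n)) < e \<and> absv (sum f (F n) - S) < e"
      by eventually_elim simp
    then obtain n where n: "inverse (real (Suc n)) < e" "absv (sum f (F n) - S) < e"
      using eventually_happens'[OF sequentially_bot] by force
    have "absv (sum f Y - S) < e" if "finite Y" "F n \<subseteq> Y" "Y \<subseteq> A" for Y
    proof -
      have "absv (sum f Y - sum f (F n)) < e"
        using close[OF that] n by simp
      from absv_add_less[OF this n(2)] show ?thesis
        by simp
    qed
    then show "\<exists>F. finite F \<and> F \<subseteq> A \<and>
             (\<forall>Y. finite Y \<and> F \<subseteq> Y \<and> Y \<subseteq> A \<longrightarrow> absv (sum f Y - S) < e)"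
      using F by (intro exI[of _ "F n"]) simp
  qed
qed

text \<open>Finite partial sums stay in \<open>K\<close>, and the sum is their limit. This keeps
  coefficients in the base field when a series is rearranged.\<close>

lemma has_sum_in_closed_subgroup:
  fixes f :: "'i \<Rightarrow> 'k::nonarch_field"
  assumes "(f has_sum S) A" and "closed K" and "\<And>i. i \<in> A \<Longrightarrow> f i \<in> K"
    and "0 \<in> K" and "\<And>x y. x \<in> K \<Longrightarrow> y \<in> K \<Longrightarrow> x + y \<in> K"
  shows "S \<in> K"
proof (rule Lim_in_closed_set[OF \<open>closed K\<close>])
  show "(sum f \<longlongrightarrow> S) (finite_subsets_at_top A)"
    using assms(1) by (simp add: has_sum_def)
  have "sum f Y \<in> K" if "finite Y" "Y \<subseteq> A" for Y
    using that by induction (use assms in auto)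
  then show "\<forall>\<^sub>F Y in finite_subsets_at_top A. sum f Y \<in> K"
    by (intro eventually_finite_subsets_at_top_weakI)
qed simp

section \<open>The operator on sums over roots\<close>

lemma degree_monom_minus_const:
  "n > 0 \<Longrightarrow> Polynomial.degree (Polynomial.monom 1 n - [:x:] :: 'a::field poly) = n"
  by (rule antisym[OF degree_le le_degree]) (auto simp: coeff_pCons split: nat.splits)

lemma monom_minus_const_nonzero:
  "n > 0 \<Longrightarrow> Polynomial.monom 1 n \<noteq> [:x :: 'a::field:]"
  using degree_monom_minus_const[of n x] by force

lemma size_proots_alg_closed:
  fixes f :: "'a::alg_closed_field poly"
  shows "size (proots f) = Polynomial.degree f"
proof (cases "f = 0")
  case False
  then obtain A where A: "size A = Polynomial.degree f" "f = Polynomial.smult (Polynomial.lead_coeff f) (\<Prod>x\<in>#A. [:-x, 1:])"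
    using alg_closed_imp_factorization by blast
  have "proots f = proots (\<Prod>x\<in>#A. [:-x, 1:])"
    by (subst A(2)) (use False in simp)
  also have "\<dots> = (\<Sum>x\<in>#A. proots [:-x, 1:])"
  proof -
    have "0 \<notin># image_mset (\<lambda>x. [:-x, 1:]) A"
      by auto
    from proots_prod_mset[OF this] show ?thesis
      by (simp add: image_mset.compositionality o_def)
  qed
  also have "\<dots> = A"
    by simp
  finally show ?thesis
    using A(1) by simp
qed simp

lemma set_proots_monom_minus_const:
  "n > 0 \<Longrightarrow> set_mset (proots (Polynomial.monom 1 n - [:x:])) = {z :: 'a::field. z ^ n = x}"
  by (simp add: monom_minus_const_nonzero poly_monom)

text \<open>The derivative \<open>n * z ^ (n - 1)\<close> vanishes at most at \<open>0\<close>,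
  which is no root when \<open>x \<noteq> 0\<close>; hence all roots are simple and the multiset is
  a set.\<close>

lemma proots_monom_minus_const:
  fixes x :: "'a::{alg_closed_field, field_char_0}"
  assumes "n > 0" "x \<noteq> 0"
  shows "proots (Polynomial.monom 1 n - [:x:]) = mset_set {z. z ^ n = x}"
proof (rule multiset_eqI)
  fix z
  let ?f = "Polynomial.monom 1 n - [:x:] :: 'a poly"
  have "rsquarefree ?f"
    using assms by (auto simp: rsquarefree_roots poly_monom pderiv_diff pderiv_monom pderiv_pCons)
  moreover have "finite {z. z ^ n = x}"
    using set_proots_monom_minus_const[OF assms(1), of x] by (metis finite_set_mset)
  ultimately show "count (proots ?f) z = count (mset_set {z. z ^ n = x}) z"
    using assms(1) by (cases "z ^ n = x")
      (auto simp: monom_minus_const_nonzero poly_monom rsquarefree_root_order order_0I)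
qed

lemma nth_roots:
  fixes x :: "'a::{alg_closed_field, field_char_0}"
  assumes "n > 0"
  shows finite_nth_roots: "finite {z. z ^ n = x}"
    and card_nth_roots_alg_closed: "x \<noteq> 0 \<Longrightarrow> card {z. z ^ n = x} = n"
proof -
  show "finite {z. z ^ n = x}"
    using set_proots_monom_minus_const[OF assms(1), of x] by (metis finite_set_mset)
  show "card {z. z ^ n = x} = n" if "x \<noteq> 0"
    using size_proots_alg_closed[of "Polynomial.monom 1 n - [:x:]"] that assms
    by (simp add: proots_monom_minus_const degree_monom_minus_const)
qed

section \<open>Formal rules for the operator\<close>

lemma U_op_nonzero:
  assumes "n > 0" "x \<noteq> 0"
  shows "U_op n \<xi> x = (\<Sum>z | z ^ n = x. \<xi> z) / of_nat n"
  using assms by (simp add: U_op_def proots_monom_minus_const sum_unfold_sum_mset)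

lemma U_op_0:
  assumes "n > 0"
  shows "U_op n \<xi> (0 :: 'k::nonarch_field) = \<xi> 0"
proof -
  have "Polynomial.monom 1 n = ([:0, 1:] :: 'k poly) ^ n"
    by (simp add: monom_altdef)
  then have "proots (Polynomial.monom 1 n - [:0:] :: 'k poly) = repeat_mset n {#0#}"
    using proots_linear_factor[of "0::'k"] by (simp add: proots_power)
  also have "\<dots> = replicate_mset n 0"
    by (simp add: multiset_eq_iff)
  finally show ?thesis
    using assms by (simp add: U_op_def)
qed

text \<open>For \<open>x \<noteq> 0\<close> the solutions of \<open>z ^ (m * n) = x\<close> are
  partitioned by the value \<open>y = z ^ n\<close>, which runs through the solutions of
  \<open>y ^ m = x\<close>. At \<open>0\<close> both sides reduce to \<open>\<xi> 0\<close>.\<close>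

lemma U_op_mult:
  assumes "m > 0" "n > 0"
  shows "U_op (m * n) \<xi> x = U_op m (U_op n \<xi>) x"
proof (cases "x = 0")
  case True
  then show ?thesis
    using assms by (simp add: U_op_0)
next
  case False
  have "(\<Sum>y | y ^ m = x. U_op n \<xi> y) = (\<Sum>y | y ^ m = x. (\<Sum>z | z ^ n = y. \<xi> z) / of_nat n)"
    using assms False by (intro sum.cong) (auto simp: U_op_nonzero)
  also have "\<dots> = (\<Sum>y | y ^ m = x. \<Sum>z | z ^ n = y. \<xi> z) / of_nat n"
    by (simp add: sum_divide_distrib)
  also have "(\<Sum>y | y ^ m = x. \<Sum>z | z ^ n = y. \<xi> z)
      = sum \<xi> (\<Union>y\<in>{y. y ^ m = x}. {z. z ^ n = y})"
    using assms by (intro sum.UNION_disjoint[symmetric]) (auto intro: finite_nth_roots)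
  also have "(\<Union>y\<in>{y. y ^ m = x}. {z. z ^ n = y}) = {z. z ^ (m * n) = x}"
    by (auto simp: power_mult mult.commute[of m])
  finally show ?thesis
    using assms False by (simp add: U_op_nonzero)
qed

lemma U_op_power:
  assumes "n > 0"
  shows "(U_op (n ^ a) :: ('k \<Rightarrow> 'k) \<Rightarrow> 'k \<Rightarrow> 'k::nonarch_field) = U_op n ^^ a"
proof (induction a)
  case 0
  have "U_op 1 \<xi> x = \<xi> x" for \<xi> and x :: 'k
    by (cases "x = 0") (simp_all add: U_op_0 U_op_nonzero)
  then show ?case
    by (simp add: fun_eq_iff)
next
  case (Suc a)
  then show ?case
    using assms by (intro ext) (simp add: U_op_mult)
qed

lemma U_op_cong:
  assumes "n > 0" and "\<And>z. z ^ n = x \<Longrightarrow> f z = g z"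
  shows "U_op n f x = U_op n g x"
  unfolding U_op_def using assms
  by (intro arg_cong[where f = "\<lambda>u. u / _"] arg_cong[where f = sum_mset] image_mset_cong)
    (simp add: set_proots_monom_minus_const)

lemma U_op_add: "U_op n (\<lambda>z. f z + g z) x = U_op n f x + U_op n g x"
  by (simp add: U_op_def sum_mset.distrib add_divide_distrib)

lemma U_op_const_mult: "U_op n (\<lambda>z. c * f z) x = c * U_op n f x"
  by (simp add: U_op_def sum_mset_distrib_left[symmetric])

lemma U_op_sum: "U_op n (\<lambda>z. \<Sum>i\<in>A. f i z) x = (\<Sum>i\<in>A. U_op n (f i) x)"
proof (induction A rule: infinite_finite_induct)
  case (insert i A)
  then show ?case
    by (simp add: U_op_add)
qed (simp_all add: U_op_def)

lemma U_op_has_sum: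
  assumes "n > 0" and "\<And>z. z ^ n = x \<Longrightarrow> ((\<lambda>i. f i z) has_sum g z) A"
  shows "((\<lambda>i. U_op n (f i) x) has_sum U_op n g x) A"
proof -
  have "((\<lambda>i. \<Sum>z\<in>#M. f i z) has_sum (\<Sum>z\<in>#M. g z)) A" if "\<forall>z\<in>#M. z ^ n = x" for M
    using that by (induction M) (auto intro!: has_sum_add assms(2))
  then have "((\<lambda>i. \<Sum>z\<in>#proots (Polynomial.monom 1 n - [:x:]). f i z) has_sum
      (\<Sum>z\<in>#proots (Polynomial.monom 1 n - [:x:]). g z)) A"
    using assms(1) by (simp add: set_proots_monom_minus_const)
  from has_sum_cmult_left[OF this, of "inverse (of_nat n)"] show ?thesis
    by (simp add: U_op_def divide_inverse)
qed

text \<open>As \<open>i\<close> is invertible modulo \<open>p\<close>, some power of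
  \<open>\<zeta> ^ i\<close> is \<open>\<zeta>\<close> itself.\<close>

lemma prime_root_of_unity_power_eq_1:
  fixes \<zeta> :: "'a::field"
  assumes "Factorial_Ring.prime p" "\<zeta> ^ p = 1" "\<zeta> ^ i = 1" "\<not> p dvd i"
  shows "\<zeta> = 1"
proof -
  have "coprime i p"
    using assms Factorial_Ring.prime_imp_coprime[of p i] by (simp add: coprime_commute[of i p])
  moreover have "p \<noteq> 1"
    using assms(1) by auto
  ultimately obtain m n where mn: "i * m = p * n + 1"
    using coprime_bezout_strong by blast
  have "1 = \<zeta> ^ (p * n + 1)"
    unfolding mn[symmetric] using assms(3) by (simp add: power_mult)
  then show ?thesis
    using assms(2) by (simp add: power_mult)
qed

text \<open>If \<open>p\<close> divides \<open>i\<close>, the monomial is constant on the fibre over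
  \<open>x\<close>. Otherwise multiplication by a primitive \<open>p\<close>-th root of unity
  \<open>\<zeta>\<close> permutes the fibre and multiplies the sum by
  \<open>\<zeta> ^ i \<noteq> 1\<close>, so the sum is \<open>0\<close>.\<close>

lemma U_op_prime_monomial:
  fixes x :: "'k::nonarch_field"
  assumes p: "Factorial_Ring.prime p"
  shows "U_op p (\<lambda>z. z ^ i) x = (if p dvd i then x ^ (i div p) else 0)"
proof (cases "x = 0")
  case True
  then show ?thesis
    using p by (auto simp: U_op_0 prime_gt_0_nat power_0_left dvd_div_eq_0_iff intro!: Nat.gr0I)
next
  case False
  have p0: "p > 0"
    using p prime_gt_0_nat by blast
  show ?thesis
  proof (cases "p dvd i")
    case True
    then obtain k where k: "i = p * k" ..
    have "(\<Sum>z | z ^ p = x. z ^ i) = (\<Sum>z | z ^ p = x. x ^ k)"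
      by (intro sum.cong) (auto simp: k power_mult)
    then show ?thesis
      using p0 False by (simp add: U_op_nonzero card_nth_roots_alg_closed k)
  next
    case ndvd: False
    have "{\<zeta> :: 'k. \<zeta> ^ p = 1} \<noteq> {1}"
      using card_nth_roots_alg_closed[OF p0, of "1::'k"] prime_gt_1_nat[OF p] by force
    then obtain \<zeta> :: 'k where \<zeta>: "\<zeta> ^ p = 1" "\<zeta> \<noteq> 1"
      by auto
    then have "\<zeta> ^ i \<noteq> 1" and [simp]: "\<zeta> \<noteq> 0"
      using prime_root_of_unity_power_eq_1[OF p _ _ ndvd] p0 by (auto simp: power_0_left)
    have "(\<Sum>z | z ^ p = x. z ^ i) = (\<Sum>z | z ^ p = x. (\<zeta> * z) ^ i)"
      by (rule sum.reindex_bij_witness[of _ "\<lambda>z. \<zeta> * z" "\<lambda>z. z / \<zeta>"])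
        (auto simp: power_mult_distrib power_divide \<zeta>)
    also have "\<dots> = \<zeta> ^ i * (\<Sum>z | z ^ p = x. z ^ i)"
      by (simp add: power_mult_distrib sum_distrib_left)
    finally have "(\<zeta> ^ i - 1) * (\<Sum>z | z ^ p = x. z ^ i) = 0"
      by (simp add: algebra_simps)
    then show ?thesis
      using \<open>\<zeta> ^ i \<noteq> 1\<close> ndvd p0 False by (simp add: U_op_nonzero)
  qed
qed

section \<open>Polynomials and null series in the coordinates\<close>

text \<open>The coordinates \<open>y\<close> are a parameter so that the same monomials serve both
  the affinoid of \<open>z\<close> and that of \<open>z ^ p\<close>.\<close>

definition coord_monomial :: "nat \<Rightarrow> (nat \<Rightarrow> 'k::nonarch_field) \<Rightarrow> (nat \<Rightarrow> nat) \<Rightarrow> 'k" where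
  "coord_monomial l y \<nu> = (\<Prod>j\<in>{1..l}. y j ^ \<nu> j)"

lemma coord_monomial_upd:
  assumes "j \<in> {1..l}"
  shows "coord_monomial l y (\<nu>(j := \<nu> j + n)) = y j ^ n * coord_monomial l y \<nu>"
proof -
  have "coord_monomial l y (\<nu>(j := m)) = y j ^ m * (\<Prod>i\<in>{1..l} - {j}. y i ^ \<nu> i)" for m
    unfolding coord_monomial_def using assms
    by (subst prod.remove[of _ j]) (auto intro!: prod.cong)
  from this[of "\<nu> j + n"] this[of "\<nu> j"] show ?thesis
    by (simp add: power_add)
qed

lemma multi_indices_upd:
  "\<nu> \<in> multi_indices l \<Longrightarrow> j \<in> {1..l} \<Longrightarrow> \<nu>(j := n) \<in> multi_indices l"
  by (auto simp: multi_indices_def PiE_iff extensional_def)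

lemma absv_coord_monomial_le_1:
  "(\<And>j. j \<in> {1..l} \<Longrightarrow> absv (y j) \<le> 1) \<Longrightarrow> absv (coord_monomial l y \<nu>) \<le> 1"
  by (auto simp: coord_monomial_def absv_prod intro!: prod_le_1 power_le_one)

text \<open>Functions are only compared on \<open>S\<close>.\<close>

inductive_set coord_polys ::
    "'k::nonarch_field set \<Rightarrow> nat \<Rightarrow> 'x set \<Rightarrow> ('x \<Rightarrow> nat \<Rightarrow> 'k) \<Rightarrow> ('x \<Rightarrow> 'k) set"
  for C l S y where
  zero: "(\<lambda>x. 0) \<in> coord_polys C l S y"
| step: "f \<in> coord_polys C l S y \<Longrightarrow> c \<in> C \<Longrightarrow> \<nu> \<in> multi_indices l \<Longrightarrow>
    (\<And>x. x \<in> S \<Longrightarrow> g x = f x + c * coord_monomial l (y x) \<nu>) \<Longrightarrow> g \<in> coord_polys C l S y"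

text \<open>One \<open>step\<close> with coefficient \<open>0\<close> absorbs any change of the
  function outside \<open>S\<close>.\<close>

lemma coord_polys_cong:
  assumes "f \<in> coord_polys C l S y" "0 \<in> C" "\<And>x. x \<in> S \<Longrightarrow> g x = f x"
  shows "g \<in> coord_polys C l S y"
  by (rule coord_polys.step[OF assms(1,2), of "restrict (\<lambda>_. 0) {1..l}"])
    (auto simp: assms(3) multi_indices_def)

lemma coord_polys_add:
  assumes "g \<in> coord_polys C l S y" "f \<in> coord_polys C l S y"
  shows "(\<lambda>x. f x + g x) \<in> coord_polys C l S y"
  using assms
proof induction
  case (step h c \<nu> g)
  show ?case
    by (rule coord_polys.step[OF step.IH[OF step.prems] step.hyps(2,3)])
      (simp add: step.hyps(4) add.assoc)
qed simp

lemma coord_polys_sum: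
  "(\<And>i. i \<in> I \<Longrightarrow> f i \<in> coord_polys C l S y) \<Longrightarrow> (\<lambda>x. \<Sum>i\<in>I. f i x) \<in> coord_polys C l S y"
  by (induction I rule: infinite_finite_induct) (auto intro: coord_polys.zero coord_polys_add)

lemma coord_polys_scale:
  assumes "f \<in> coord_polys C l S y" "\<And>c. c \<in> C \<Longrightarrow> a * c \<in> D"
  shows "(\<lambda>x. a * f x) \<in> coord_polys D l S y"
  using assms(1)
proof induction
  case zero
  then show ?case
    by (simp add: coord_polys.zero)
next
  case (step h c \<nu> g)
  show ?case
    by (rule coord_polys.step[OF step.IH assms(2)[OF step.hyps(2)] step.hyps(3)])
      (simp add: step.hyps(4) algebra_simps)
qed

lemma coord_polys_mult_coord:
  assumes "f \<in> coord_polys C l S y" "j \<in> {1..l}"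
  shows "(\<lambda>x. y x j * f x) \<in> coord_polys C l S y"
  using assms(1)
proof induction
  case zero
  then show ?case
    by (simp add: coord_polys.zero)
next
  case (step h c \<nu> g)
  show ?case
    by (rule coord_polys.step[OF step.IH step.hyps(2) multi_indices_upd[OF step.hyps(3) assms(2)],
          of _ "\<nu> j + 1"])
      (simp add: step.hyps(4) coord_monomial_upd[OF assms(2), of _ \<nu> 1, simplified] algebra_simps)
qed

lemma coord_polys_1:
  assumes "1 \<in> C"
  shows "(\<lambda>x. 1) \<in> coord_polys C l S y"
  by (rule coord_polys.step[OF coord_polys.zero assms, of "restrict (\<lambda>_. 0) {1..l}"])
    (auto simp: coord_monomial_def multi_indices_def)

lemma coord_polys_coord_power:
  "1 \<in> C \<Longrightarrow> j \<in> {1..l} \<Longrightarrow> (\<lambda>x. y x j ^ n) \<in> coord_polys C l S y"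
  by (induction n) (auto intro: coord_polys_1 dest: coord_polys_mult_coord)

text \<open>Letting \<open>b\<close> vanish off \<open>F\<close> allows the sum to be extended to
  any larger finite index set, which is how finitely many expansions get a common one.\<close>

lemma coord_polys_expand:
  assumes "f \<in> coord_polys C l S y" and "0 \<in> C" and "\<And>a b. a \<in> C \<Longrightarrow> b \<in> C \<Longrightarrow> a + b \<in> C"
  obtains F b where "finite F" "F \<subseteq> multi_indices l" "\<And>\<nu>. b \<nu> \<in> C" "\<And>\<nu>. \<nu> \<notin> F \<Longrightarrow> b \<nu> = 0"
    "\<And>x. x \<in> S \<Longrightarrow> f x = (\<Sum>\<nu>\<in>F. b \<nu> * coord_monomial l (y x) \<nu>)"
proof -
  have "\<exists>F b. finite F \<and> F \<subseteq> multi_indices l \<and> (\<forall>\<nu>. b \<nu> \<in> C) \<and> (\<forall>\<nu>. \<nu> \<notin> F \<longrightarrow> b \<nu> = 0) \<and>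
      (\<forall>x\<in>S. f x = (\<Sum>\<nu>\<in>F. b \<nu> * coord_monomial l (y x) \<nu>))"
    using assms(1)
  proof induction
    case zero
    show ?case
      by (rule exI[of _ "{}"], rule exI[of _ "\<lambda>_. 0"]) (use assms in auto)
  next
    case (step f c \<nu> g)
    then obtain F b where F: "finite F" "F \<subseteq> multi_indices l" "\<And>\<nu>. b \<nu> \<in> C"
      "\<And>\<nu>. \<nu> \<notin> F \<Longrightarrow> b \<nu> = 0" "\<And>x. x \<in> S \<Longrightarrow> f x = (\<Sum>\<nu>\<in>F. b \<nu> * coord_monomial l (y x) \<nu>)"
      by blast
    have "g x = (\<Sum>\<mu>\<in>insert \<nu> F. (b(\<nu> := b \<nu> + c)) \<mu> * coord_monomial l (y x) \<mu>)" if "x \<in> S" for x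
    proof -
      have "(\<Sum>\<mu>\<in>insert \<nu> F. (b(\<nu> := b \<nu> + c)) \<mu> * coord_monomial l (y x) \<mu>)
          = (\<Sum>\<mu>\<in>insert \<nu> F. b \<mu> * coord_monomial l (y x) \<mu>
              + (if \<mu> = \<nu> then c * coord_monomial l (y x) \<nu> else 0))"
        by (intro sum.cong) (auto simp: algebra_simps)
      also have "\<dots> = (\<Sum>\<mu>\<in>insert \<nu> F. b \<mu> * coord_monomial l (y x) \<mu>) + c * coord_monomial l (y x) \<nu>"
        using F(1) by (simp add: sum.distrib)
      also have "(\<Sum>\<mu>\<in>insert \<nu> F. b \<mu> * coord_monomial l (y x) \<mu>) = f x"
        using F(1,4) that by (subst F(5)) (auto intro!: sum.mono_neutral_right)
      finally show ?thesis
        using step.hyps(4)[OF that] by simp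
    qed
    then show ?case
      using F step.hyps(2,3) assms(3)
      by (intro exI[of _ "insert \<nu> F"] exI[of _ "b(\<nu> := b \<nu> + c)"]) auto
  qed
  then show thesis
    using that by blast
qed

text \<open>Subfields in terms of the operations of the type; \<open>subfield_field_ring_iff\<close>
  identifies them with the subfields of \<open>field_ring\<close>. The closure under
  \<open>inverse\<close> can include \<open>0\<close> because \<open>inverse 0 = 0\<close>.\<close>

locale nonarch_subfield =
  fixes K :: "'k::nonarch_field set"
  assumes zero_mem: "0 \<in> K" and one_mem: "1 \<in> K"
    and add_mem: "x \<in> K \<Longrightarrow> y \<in> K \<Longrightarrow> x + y \<in> K"
    and minus_mem: "x \<in> K \<Longrightarrow> - x \<in> K"
    and mult_mem: "x \<in> K \<Longrightarrow> y \<in> K \<Longrightarrow> x * y \<in> K"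
    and inverse_mem: "x \<in> K \<Longrightarrow> inverse x \<in> K"
begin

lemma diff_mem: "x \<in> K \<Longrightarrow> y \<in> K \<Longrightarrow> x - y \<in> K"
  using add_mem[of x "- y"] minus_mem by simp

lemma divide_mem: "x \<in> K \<Longrightarrow> y \<in> K \<Longrightarrow> x / y \<in> K"
  by (simp add: divide_inverse mult_mem inverse_mem)

lemma power_mem: "x \<in> K \<Longrightarrow> x ^ n \<in> K"
  by (induction n) (auto intro: one_mem mult_mem)

lemma of_nat_mem: "of_nat n \<in> K"
  by (induction n) (auto intro: zero_mem one_mem add_mem)

lemma sum_mem: "(\<And>i. i \<in> I \<Longrightarrow> f i \<in> K) \<Longrightarrow> sum f I \<in> K"
  by (induction I rule: infinite_finite_induct) (auto intro: zero_mem add_mem)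

lemma zero_mem_valuation_ring: "0 \<in> valuation_ring K"
  by (simp add: valuation_ring_def zero_mem)

lemma one_mem_valuation_ring: "1 \<in> valuation_ring K"
  by (simp add: valuation_ring_def one_mem)

lemma add_mem_valuation_ring:
  "a \<in> valuation_ring K \<Longrightarrow> b \<in> valuation_ring K \<Longrightarrow> a + b \<in> valuation_ring K"
  by (auto simp: valuation_ring_def intro: add_mem absv_add_le)

lemma minus_mem_valuation_ring: "a \<in> valuation_ring K \<Longrightarrow> - a \<in> valuation_ring K"
  by (auto simp: valuation_ring_def intro: minus_mem)

lemma mult_mem_valuation_ring:
  "a \<in> valuation_ring K \<Longrightarrow> b \<in> valuation_ring K \<Longrightarrow> a * b \<in> valuation_ring K"
  by (auto simp: valuation_ring_def absv_mult intro: mult_mem mult_le_one)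

text \<open>Only finitely many coefficients occur, so a product of integral multipliers, one for
  each, makes all of them integral.\<close>

lemma coord_polys_denominator:
  assumes "f \<in> coord_polys K l S y"
  obtains a where "a \<in> valuation_ring K" "a \<noteq> 0"
    "(\<lambda>x. a * f x) \<in> coord_polys (valuation_ring K) l S y"
proof -
  have "\<exists>a \<in> valuation_ring K. a \<noteq> 0 \<and> (\<lambda>x. a * f x) \<in> coord_polys (valuation_ring K) l S y"
    using assms
  proof induction
    case zero
    then show ?case
      by (intro bexI[of _ 1]) (auto intro: coord_polys.zero one_mem_valuation_ring)
  next
    case (step f c \<nu> g)
    then obtain a where a: "a \<in> valuation_ring K" "a \<noteq> 0"
      "(\<lambda>x. a * f x) \<in> coord_polys (valuation_ring K) l S y"
      by blast
    \<comment> \<open>A coefficient that is not integral has an integral inverse, and multiplying by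
      that inverse turns it into \<open>1\<close>.\<close>
    define d where "d = (if absv c \<le> 1 then 1 else inverse c)"
    have d: "d \<in> valuation_ring K" "d * c \<in> valuation_ring K" "d \<noteq> 0"
    proof -
      have "inverse (absv c) \<le> 1" "c \<noteq> 0" if "\<not> absv c \<le> 1"
        using that by (auto simp: inverse_le_1_iff)
      then show "d \<in> valuation_ring K" "d * c \<in> valuation_ring K" "d \<noteq> 0"
        using step.hyps(2) by (auto simp: d_def valuation_ring_def one_mem inverse_mem)
    qed
    have "(\<lambda>x. d * a * g x) \<in> coord_polys (valuation_ring K) l S y"
    proof (rule coord_polys.step[OF coord_polys_scale[OF a(3), of d] _ step.hyps(3)])
      show "a * (d * c) \<in> valuation_ring K"
        using a(1) d(2) by (rule mult_mem_valuation_ring)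
      show "d * a * g x = d * (a * f x) + a * (d * c) * coord_monomial l (y x) \<nu>" if "x \<in> S" for x
        using step.hyps(4)[OF that] by (simp add: algebra_simps)
    qed (use d mult_mem_valuation_ring in auto)
    then show ?case
      using a d by (intro bexI[of _ "d * a"]) (auto intro: mult_mem_valuation_ring)
  qed
  then show thesis
    using that by blast
qed

text \<open>The coefficients of the rearranged series are the column sums of \<open>c \<nu> * b \<nu> \<mu>\<close>.\<close>

lemma null_combination_of_coord_polys:
  assumes K: "closed K" and c: "\<And>\<nu>. \<nu> \<in> I \<Longrightarrow> c \<nu> \<in> K"
    and null: "\<And>e. e > 0 \<Longrightarrow> finite {\<nu> \<in> I. absv (c \<nu>) \<ge> e}"
    and g: "\<And>\<nu>. \<nu> \<in> I \<Longrightarrow> g \<nu> \<in> coord_polys (valuation_ring K) l S y"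
    and y: "\<And>x j. x \<in> S \<Longrightarrow> j \<in> {1..l} \<Longrightarrow> absv (y x j) \<le> 1"
    and h: "\<And>x. x \<in> S \<Longrightarrow> ((\<lambda>\<nu>. c \<nu> * g \<nu> x) has_sum h x) I"
  obtains d where "d \<in> tate_algebra K l"
    "\<And>x. x \<in> S \<Longrightarrow> ((\<lambda>\<mu>. d \<mu> * coord_monomial l (y x) \<mu>) has_sum h x) (multi_indices l)"
proof -
  define expands where "expands \<nu> F b \<longleftrightarrow> finite F \<and> F \<subseteq> multi_indices l \<and>
      (\<forall>\<mu>. b \<mu> \<in> valuation_ring K) \<and> (\<forall>\<mu>. \<mu> \<notin> F \<longrightarrow> b \<mu> = 0) \<and>
      (\<forall>x\<in>S. g \<nu> x = (\<Sum>\<mu>\<in>F. b \<mu> * coord_monomial l (y x) \<mu>))" for \<nu> F b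
  have "\<exists>Fb. expands \<nu> (fst Fb) (snd Fb)" if \<nu>: "\<nu> \<in> I" for \<nu>
  proof -
    obtain F b where "finite F" "F \<subseteq> multi_indices l" "\<And>\<mu>. b \<mu> \<in> valuation_ring K"
      "\<And>\<mu>. \<mu> \<notin> F \<Longrightarrow> b \<mu> = 0"
      "\<And>x. x \<in> S \<Longrightarrow> g \<nu> x = (\<Sum>\<mu>\<in>F. b \<mu> * coord_monomial l (y x) \<mu>)"
      by (rule coord_polys_expand[OF g[OF \<nu>] zero_mem_valuation_ring add_mem_valuation_ring])
        (assumption | rule that)+
    then have "expands \<nu> F b"
      by (simp add: expands_def)
    then show ?thesis
      by (intro exI[of _ "(F, b)"]) simp
  qed
  then obtain Fb where "\<And>\<nu>. \<nu> \<in> I \<Longrightarrow> expands \<nu> (fst (Fb \<nu>)) (snd (Fb \<nu>))"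
    using bchoice[of I "\<lambda>\<nu> Fb. expands \<nu> (fst Fb) (snd Fb)"] by blast
  moreover define F b where "F \<nu> = fst (Fb \<nu>)" and "b \<nu> = snd (Fb \<nu>)" for \<nu>
  ultimately have "expands \<nu> (F \<nu>) (b \<nu>)" if "\<nu> \<in> I" for \<nu>
    using that by simp
  then have F: "\<And>\<nu>. \<nu> \<in> I \<Longrightarrow> finite (F \<nu>)" "\<And>\<nu>. \<nu> \<in> I \<Longrightarrow> F \<nu> \<subseteq> multi_indices l"
    and b: "\<And>\<nu> \<mu>. \<nu> \<in> I \<Longrightarrow> b \<nu> \<mu> \<in> valuation_ring K"
    and b0: "\<And>\<nu> \<mu>. \<nu> \<in> I \<Longrightarrow> \<mu> \<notin> F \<nu> \<Longrightarrow> b \<nu> \<mu> = 0"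
    and gb: "\<And>\<nu> x. \<nu> \<in> I \<Longrightarrow> x \<in> S \<Longrightarrow> g \<nu> x = (\<Sum>\<mu>\<in>F \<nu>. b \<nu> \<mu> * coord_monomial l (y x) \<mu>)"
    by (simp_all add: expands_def)
  have bK: "b \<nu> \<mu> \<in> K" "absv (b \<nu> \<mu>) \<le> 1" if "\<nu> \<in> I" for \<nu> \<mu>
    using b[OF that, of \<mu>] by (auto simp: valuation_ring_def)
  \<comment> \<open>An integral factor does not enlarge \<open>c \<nu>\<close>, so every column of
    the array \<open>c \<nu> * b \<nu> \<mu>\<close> is a null family.\<close>
  have cb_le: "absv (c \<nu> * b \<nu> \<mu>) \<le> absv (c \<nu>)" if "\<nu> \<in> I" for \<nu> \<mu>
    using bK[OF that] by (simp add: absv_mult mult_left_le)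
  have "\<exists>s. ((\<lambda>\<nu>. c \<nu> * b \<nu> \<mu>) has_sum s) I" for \<mu>
  proof -
    have "finite {\<nu> \<in> I. absv (c \<nu> * b \<nu> \<mu>) \<ge> e}" if "e > 0" for e
      by (rule finite_subset[OF _ null[OF that]]) (use cb_le order_trans in blast)
    then show ?thesis
      by (rule nonarch_summable)
  qed
  then obtain d where d: "\<And>\<mu>. ((\<lambda>\<nu>. c \<nu> * b \<nu> \<mu>) has_sum d \<mu>) I"
    by metis
  have dK: "d \<mu> \<in> K" for \<mu>
    by (rule has_sum_in_closed_subgroup[OF d K]) (auto intro: mult_mem c bK zero_mem add_mem)
  define J where "J e = {\<nu> \<in> I. absv (c \<nu>) \<ge> e}" for e
  have J: "finite (J e)" "J e \<subseteq> I" if "e > 0" for e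
    using null[OF that] by (auto simp: J_def)
  have tail: "absv (d \<mu> - (\<Sum>\<nu>\<in>J e. c \<nu> * b \<nu> \<mu>)) \<le> e" if "e > 0" for e \<mu>
  proof (rule absv_has_sum_tail_le[OF d J[OF that]])
    show "absv (c \<nu> * b \<nu> \<mu>) \<le> e" if "\<nu> \<in> I - J e" for \<nu>
      using cb_le[of \<nu> \<mu>] that by (auto simp: J_def)
  qed (use that in auto)
  \<comment> \<open>Outside the finitely many supports of the rows in \<open>J e\<close>, a column
    contains only terms smaller than \<open>e\<close>.\<close>
  have small: "absv (d \<mu>) \<le> e" if "e > 0" "\<mu> \<notin> (\<Union>\<nu>\<in>J e. F \<nu>)" for e \<mu>
  proof -
    have "(\<Sum>\<nu>\<in>J e. c \<nu> * b \<nu> \<mu>) = 0"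
      using that J[OF that(1)] b0 by (intro sum.neutral) auto
    then show ?thesis
      using tail[OF that(1), of \<mu>] by simp
  qed
  have "finite {\<mu> \<in> multi_indices l. absv (d \<mu>) \<ge> e}" if "e > 0" for e
  proof (rule finite_subset)
    \<comment> \<open>Since \<open>small\<close> is a weak inequality, it is applied with
      \<open>e / 2\<close> to contradict \<open>absv (d \<mu>) \<ge> e\<close>.\<close>
    show "{\<mu> \<in> multi_indices l. absv (d \<mu>) \<ge> e} \<subseteq> (\<Union>\<nu>\<in>J (e / 2). F \<nu>)"
      using small[of "e / 2"] that by force
    show "finite (\<Union>\<nu>\<in>J (e / 2). F \<nu>)"
      using J[of "e / 2"] that F(1) by auto
  qed
  then have "d \<in> tate_algebra K l"
    using dK by (auto simp: tate_algebra_def)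
  moreover have "((\<lambda>\<mu>. d \<mu> * coord_monomial l (y x) \<mu>) has_sum h x) (multi_indices l)"
    if x: "x \<in> S" for x
  proof (rule nonarch_has_sumI)
    fix e :: real
    assume "e > 0"
    define \<delta> where "\<delta> = e / 2"
    have \<delta>: "\<delta> > 0" "\<delta> < e"
      using \<open>e > 0\<close> by (auto simp: \<delta>_def)
    define G where "G = (\<Union>\<nu>\<in>J \<delta>. F \<nu>)"
    have mon: "absv (coord_monomial l (y x) \<mu>) \<le> 1" for \<mu>
      using y[OF x] by (rule absv_coord_monomial_le_1)
    have g_le: "absv (g \<nu> x) \<le> 1" if "\<nu> \<in> I" for \<nu>
      unfolding gb[OF that x] using bK(2)[OF that] mon
      by (intro absv_sum_le) (auto simp: absv_mult intro: mult_le_one)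
    have 1: "absv (h x - (\<Sum>\<nu>\<in>J \<delta>. c \<nu> * g \<nu> x)) \<le> \<delta>"
    proof (rule absv_has_sum_tail_le[OF h[OF x] J[OF \<delta>(1)]])
      show "absv (c \<nu> * g \<nu> x) \<le> \<delta>" if "\<nu> \<in> I - J \<delta>" for \<nu>
      proof -
        have "absv (c \<nu> * g \<nu> x) \<le> absv (c \<nu>)"
          using that g_le by (simp add: absv_mult mult_left_le)
        then show ?thesis
          using that by (auto simp: J_def)
      qed
    qed (use \<delta> in auto)
    \<comment> \<open>The partial sum over \<open>Y\<close> and the value \<open>h x\<close> are
      both compared with the finite sum over the rows in \<open>J \<delta>\<close>, where rows and
      columns may be exchanged. Each is within \<delta> of it, hence they are within \<delta> of
      each other.\<close>
    have "absv ((\<Sum>\<mu>\<in>Y. d \<mu> * coord_monomial l (y x) \<mu>) - h x) < e"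
      if Y: "finite Y" "G \<subseteq> Y" "Y \<subseteq> multi_indices l" for Y
    proof -
      have "(\<Sum>\<nu>\<in>J \<delta>. c \<nu> * g \<nu> x) = (\<Sum>\<nu>\<in>J \<delta>. \<Sum>\<mu>\<in>Y. c \<nu> * b \<nu> \<mu> * coord_monomial l (y x) \<mu>)"
      proof (rule sum.cong)
        fix \<nu>
        assume \<nu>: "\<nu> \<in> J \<delta>"
        then have I: "\<nu> \<in> I"
          using J[OF \<delta>(1)] by auto
        have "g \<nu> x = (\<Sum>\<mu>\<in>Y. b \<nu> \<mu> * coord_monomial l (y x) \<mu>)"
          unfolding gb[OF I x] using Y \<nu> b0[OF I]
          by (intro sum.mono_neutral_left) (auto simp: G_def)
        then show "c \<nu> * g \<nu> x = (\<Sum>\<mu>\<in>Y. c \<nu> * b \<nu> \<mu> * coord_monomial l (y x) \<mu>)"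
          by (simp add: sum_distrib_left mult.assoc)
      qed simp
      also have "\<dots> = (\<Sum>\<mu>\<in>Y. (\<Sum>\<nu>\<in>J \<delta>. c \<nu> * b \<nu> \<mu>) * coord_monomial l (y x) \<mu>)"
        by (subst sum.swap) (simp add: sum_distrib_right)
      finally have "(\<Sum>\<mu>\<in>Y. d \<mu> * coord_monomial l (y x) \<mu>) - (\<Sum>\<nu>\<in>J \<delta>. c \<nu> * g \<nu> x)
          = (\<Sum>\<mu>\<in>Y. (d \<mu> - (\<Sum>\<nu>\<in>J \<delta>. c \<nu> * b \<nu> \<mu>)) * coord_monomial l (y x) \<mu>)"
        by (simp add: sum_subtractf algebra_simps)
      also have "absv \<dots> \<le> \<delta>"
      proof (rule absv_sum_le)
        fix \<mu>
        show "absv ((d \<mu> - (\<Sum>\<nu>\<in>J \<delta>. c \<nu> * b \<nu> \<mu>)) * coord_monomial l (y x) \<mu>) \<le> \<delta>"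
          using tail[OF \<delta>(1), of \<mu>] mon[of \<mu>]
          by (simp add: absv_mult) (metis absv_nonneg mult_left_le order_trans)
      qed (use \<delta> in auto)
      finally have 2: "absv ((\<Sum>\<mu>\<in>Y. d \<mu> * coord_monomial l (y x) \<mu>) - (\<Sum>\<nu>\<in>J \<delta>. c \<nu> * g \<nu> x)) \<le> \<delta>" .
      show ?thesis
        using absv_diff_le[OF 2 1] \<delta> by simp
    qed
    moreover have "finite G" "G \<subseteq> multi_indices l"
      using J[OF \<delta>(1)] F by (auto simp: G_def)
    ultimately show "\<exists>F. finite F \<and> F \<subseteq> multi_indices l \<and> (\<forall>Y. finite Y \<and> F \<subseteq> Y \<and> Y \<subseteq> multi_indices l \<longrightarrow>
        absv ((\<Sum>\<mu>\<in>Y. d \<mu> * coord_monomial l (y x) \<mu>) - h x) < e)"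
      by (intro exI[of _ G]) auto
  qed
  ultimately show thesis
    by (rule that)
qed

end

section \<open>The map from one affinoid to the next\<close>

lemma power_diff_binomial:
  fixes h b :: "'a::comm_ring_1"
  shows "(b + h) ^ n - b ^ n = (\<Sum>i\<in>{1..n}. of_nat (n choose i) * h ^ i * b ^ (n - i))"
proof -
  have "{..n} = insert 0 {1..n}"
    by auto
  then show ?thesis
    using binomial_ring[of h b n] by (simp add: add.commute)
qed

lemma absv_sum_less:
  fixes f :: "'i \<Rightarrow> 'k::nonarch_field"
  assumes "\<And>i. i \<in> A \<Longrightarrow> absv (f i) < b" and "b > 0"
  shows "absv (sum f A) < b"
  using assms by (induction A rule: infinite_finite_induct) (auto intro: absv_add_less)

lemma absv_prime_choose_le:
  assumes "Factorial_Ring.prime p" "absv (of_nat p :: 'k::nonarch_field) = 1 / real p" "0 < i" "i < p"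
  shows "absv (of_nat (p choose i) :: 'k) \<le> 1 / real p"
proof -
  have "p dvd (p choose i)"
    using assms by (intro dvd_choose_prime) auto
  then obtain m where "p choose i = p * m" ..
  then show ?thesis
    using assms(2) absv_of_nat_le_1[where ?'k = 'k, of m]
    by (simp add: absv_mult divide_right_mono)
qed

text \<open>The setting of one application of \<open>U_op p\<close>: from radius
  \<open>absv \<rho>\<close> and centres \<open>P j ^ s\<close> to their \<open>p\<close>-th powers.
  Multiplied by \<open>absv \<rho>\<close>, the condition \<open>\<rho>_gt\<close> says that
  \<open>p * \<rho>\<close> is smaller than \<open>\<rho> ^ p\<close>; this controls the binomial
  terms divisible by \<open>p\<close>.\<close>

locale U_op_step = nonarch_subfield K for K :: "'k::nonarch_field set" +
  fixes p l s :: nat and P :: "nat \<Rightarrow> 'k" and \<rho> :: 'k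
  assumes closed_K: "closed K" and prime_p: "Factorial_Ring.prime p"
    and absv_p: "absv (of_nat p :: 'k) = 1 / real p"
    and l: "l \<ge> 1" and \<rho>_mem: "\<rho> \<in> K"
    and \<rho>_gt: "1 / real p < absv \<rho> ^ (p - 1)" and \<rho>_lt: "absv \<rho> < 1"
    and P_mem: "j \<in> {2..l} \<Longrightarrow> P j \<in> K" and P_le: "j \<in> {2..l} \<Longrightarrow> absv (P j) \<le> 1"
begin

abbreviation w :: "'k \<Rightarrow> nat \<Rightarrow> 'k" where "w \<equiv> affinoid_coord P \<rho> s"
abbreviation y :: "'k \<Rightarrow> nat \<Rightarrow> 'k" where "y \<equiv> affinoid_coord P (\<rho> ^ p) (s * p)"
abbreviation S :: "'k set" where "S \<equiv> affinoid l P (absv \<rho> ^ p) (s * p)"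

lemma p_gt_1: "p > 1"
  using prime_p by (rule prime_gt_1_nat)

lemma \<rho>_nonzero [simp]: "\<rho> \<noteq> 0"
  using \<rho>_gt p_gt_1 by (auto simp: power_0_left)

lemma absv_center_le: "j \<in> {2..l} \<Longrightarrow> absv (P j ^ s) \<le> 1"
  using P_le by (simp add: power_le_one)

text \<open>In the binomial expansion the term \<open>h ^ p\<close> is small by assumption. Every
  other term carries a factor \<open>p\<close> and a factor \<open>h\<close>, so it is at most
  \<open>absv \<rho> / p\<close>, which is less than \<open>absv \<rho> ^ p\<close> by
  \<open>\<rho>_gt\<close>.\<close>

lemma absv_power_diff_less:
  fixes h b :: 'k
  assumes "absv h < absv \<rho>" "absv b \<le> 1"
  shows "absv ((b + h) ^ p - b ^ p) < absv \<rho> ^ p"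
  unfolding power_diff_binomial
proof (rule absv_sum_less)
  fix i
  assume i: "i \<in> {1..p}"
  have b: "absv (b ^ (p - i)) \<le> 1"
    using assms(2) by (simp add: power_le_one)
  show "absv (of_nat (p choose i) * h ^ i * b ^ (p - i)) < absv \<rho> ^ p"
  proof (cases "i = p")
    case True
    then show ?thesis
      using assms(1) p_gt_1 by (simp add: power_strict_mono)
  next
    case False
    have "absv (of_nat (p choose i) * h ^ i * b ^ (p - i))
        = absv (of_nat (p choose i) :: 'k) * absv h ^ i * absv (b ^ (p - i))"
      by (simp add: absv_mult)
    also have "\<dots> \<le> 1 / real p * absv h ^ i * 1"
      using absv_prime_choose_le[OF prime_p absv_p, of i] i False b
      by (intro mult_mono) auto
    also have "\<dots> \<le> 1 / real p * absv \<rho>"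
      using i assms(1) \<rho>_lt power_decreasing[of 1 i "absv h"] by (simp add: divide_right_mono)
    also have "\<dots> < absv \<rho> ^ (p - 1) * absv \<rho>"
      using \<rho>_gt by (intro mult_strict_right_mono) auto
    also have "\<dots> = absv \<rho> ^ p"
      using p_gt_1 by (simp add: power_eq_if)
    finally show ?thesis .
  qed
qed simp

text \<open>If \<open>z\<close> lay in a removed disc, \<open>absv_power_diff_less\<close> would
  place \<open>z ^ p\<close> in the corresponding removed disc of the target. Consequently, over
  \<open>S\<close>, the operator evaluates functions only at points of the source affinoid.\<close>

lemma root_mem_affinoid:
  assumes "z ^ p \<in> S"
  shows "z \<in> affinoid l P (absv \<rho>) s"
proof -
  have "absv z ^ p \<le> (1 / absv \<rho>) ^ p"
    using assms by (simp add: affinoid_def power_divide)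
  then have "absv z \<le> 1 / absv \<rho>"
    using p_gt_1 by (subst (asm) power_mono_iff) auto
  moreover have "absv (z - P j ^ s) \<ge> absv \<rho>" if j: "j \<in> {2..l}" for j
  proof (rule ccontr)
    assume "\<not> ?thesis"
    then have "absv ((P j ^ s + (z - P j ^ s)) ^ p - (P j ^ s) ^ p) < absv \<rho> ^ p"
      using absv_center_le[OF j] by (intro absv_power_diff_less) auto
    moreover have "absv (z ^ p - P j ^ (s * p)) \<ge> absv \<rho> ^ p"
      using assms j by (auto simp: affinoid_def)
    ultimately show False
      by (simp add: power_mult)
  qed
  ultimately show ?thesis
    by (simp add: affinoid_def)
qed

text \<open>Ensures that the coordinates are genuine quotients and not the default value of a
  division by \<open>0\<close>.\<close>

lemma root_ne_center:
  assumes "z ^ p \<in> S" "j \<in> {2..l}"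
  shows "z \<noteq> P j ^ s" "z ^ p \<noteq> P j ^ (s * p)"
proof -
  have "absv (z ^ p - P j ^ (s * p)) \<ge> absv \<rho> ^ p" "absv \<rho> ^ p > 0"
    using assms by (auto simp: affinoid_def)
  then show "z ^ p \<noteq> P j ^ (s * p)"
    by (metis absv_0 not_le right_minus_eq)
  then show "z \<noteq> P j ^ s"
    by (auto simp: power_mult)
qed

lemma absv_coord_le_1:
  assumes "x \<in> S" "j \<in> {1..l}"
  shows "absv (y x j) \<le> 1"
proof (cases "j = 1")
  case True
  then show ?thesis
    using assms by (simp add: affinoid_coord_def affinoid_def absv_mult field_simps)
next
  case False
  then have "absv (x - P j ^ (s * p)) \<ge> absv \<rho> ^ p" "absv \<rho> ^ p > 0"
    using assms by (auto simp: affinoid_def)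
  then show ?thesis
    using False by (simp add: affinoid_coord_def divide_le_eq)
qed

section \<open>The integral equation of a coordinate\<close>

definition root_coeff :: "nat \<Rightarrow> nat \<Rightarrow> 'k" where
  "root_coeff j i = (if j = 1 then if i = p then 1 else 0
     else of_nat (p choose i) * (P j ^ s) ^ (p - i) / \<rho> ^ (p - i))"

text \<open>For \<open>i < p\<close> the binomial coefficient has absolute value at most
  \<open>1 / p\<close>, while the denominator is at worst \<open>\<rho> ^ (p - 1)\<close>, of larger
  absolute value by \<open>\<rho>_gt\<close>. The index starts at \<open>1\<close>: for
  \<open>i = 0\<close> there would be no factor \<open>p\<close> to compensate
  \<open>\<rho> ^ p\<close>.\<close>

lemma root_coeff_mem:
  assumes "j \<in> {1..l}" "i \<in> {1..p}"
  shows "root_coeff j i \<in> valuation_ring K"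
proof (cases "j = 1")
  case True
  then show ?thesis
    using one_mem_valuation_ring zero_mem_valuation_ring by (simp add: root_coeff_def)
next
  case False
  then have j: "j \<in> {2..l}"
    using assms by auto
  have "absv (root_coeff j i) \<le> 1"
  proof (cases "i = p")
    case True
    then show ?thesis
      by (simp add: root_coeff_def)
  next
    case i: False
    have "absv ((P j ^ s) ^ (p - i)) \<le> 1"
      unfolding absv_power[of "P j ^ s"] using absv_center_le[OF j] by (intro power_le_one) auto
    then have "absv (of_nat (p choose i) * (P j ^ s) ^ (p - i)) \<le> 1 / real p * 1"
      unfolding absv_mult using absv_prime_choose_le[OF prime_p absv_p, of i] assms(2) i
      by (intro mult_mono) auto
    also have "\<dots> \<le> absv \<rho> ^ (p - 1)"
      using \<rho>_gt by simp
    also have "\<dots> \<le> absv \<rho> ^ (p - i)"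
      using \<rho>_lt assms(2) by (intro power_decreasing) auto
    finally show ?thesis
      using False by (simp add: root_coeff_def)
  qed
  moreover have "root_coeff j i \<in> K"
    using False by (simp add: root_coeff_def)
      (intro divide_mem mult_mem power_mem of_nat_mem P_mem[OF j] \<rho>_mem)
  ultimately show ?thesis
    by (simp add: valuation_ring_def)
qed

text \<open>For \<open>j \<ge> 2\<close> this is the binomial expansion of \<open>z = P j ^ s + \<rho> / w z j\<close> in \<open>z ^ p\<close>.\<close>

lemma coord_power_p:
  assumes z: "z ^ p \<in> S" and j: "j \<in> {1..l}"
  shows "w z j ^ p = y (z ^ p) j * (\<Sum>i\<in>{1..p}. root_coeff j i * w z j ^ (p - i))"
proof (cases "j = 1")
  case True
  \<comment> \<open>At the disc around infinity the coordinate is linear in \<open>z\<close>, and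
    the equation is just \<open>w ^ p = y\<close>.\<close>
  have "(\<Sum>i\<in>{1..p}. root_coeff j i * w z j ^ (p - i)) = (\<Sum>i\<in>{1..p}. if i = p then 1 else 0)"
    by (intro sum.cong) (auto simp: root_coeff_def True)
  then show ?thesis
    using p_gt_1 by (simp add: True affinoid_coord_def power_mult_distrib)
next
  case False
  then have j2: "j \<in> {2..l}"
    using j by auto
  define b u where "b = P j ^ s" and "u = z - b"
  define v where "v = z ^ p - b ^ p"
  have u: "u \<noteq> 0" and v: "v \<noteq> 0"
    using root_ne_center[OF z j2] by (auto simp: u_def v_def b_def power_mult)
  have "(\<Sum>i\<in>{1..p}. root_coeff j i * w z j ^ (p - i))
      = (\<Sum>i\<in>{1..p}. of_nat (p choose i) * u ^ i * b ^ (p - i) / u ^ p)"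
  proof (intro sum.cong refl)
    fix i
    assume i: "i \<in> {1..p}"
    then have "u ^ p = u ^ i * u ^ (p - i)"
      by (simp flip: power_add)
    then show "root_coeff j i * w z j ^ (p - i) = of_nat (p choose i) * u ^ i * b ^ (p - i) / u ^ p"
      using u False by (simp add: root_coeff_def affinoid_coord_def power_divide flip: b_def u_def)
  qed
  \<comment> \<open>Here \<open>w ^ p = \<rho> ^ p / u ^ p\<close> and
    \<open>y = \<rho> ^ p / v\<close>, so this quotient is exactly \<open>w ^ p / y\<close>.\<close>
  also have "\<dots> = v / u ^ p"
    using power_diff_binomial[of b u p] by (simp add: u_def v_def sum_divide_distrib)
  finally show ?thesis
    using u v False
    by (simp add: affinoid_coord_def power_divide power_mult flip: b_def u_def v_def)
qed

text \<open>The difference \<open>z - b\<close> divides \<open>z ^ p - b ^ p\<close> with a quotient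
  polynomial in \<open>z\<close>, which turns \<open>1 / (z - b)\<close> into a polynomial in
  \<open>z\<close> over \<open>z ^ p - b ^ p\<close>. The coefficients lie in \<open>K\<close> but
  need not be integral.\<close>

lemma coord_eq_polynomial:
  assumes z: "z ^ p \<in> S" and j: "j \<in> {2..l}"
  shows "w z j = y (z ^ p) j * (\<Sum>i<p. (P j ^ s) ^ (p - Suc i) / \<rho> ^ (p - 1) * z ^ i)"
proof -
  define b where "b = P j ^ s"
  define g where "g = (\<Sum>i<p. b ^ (p - Suc i) * z ^ i)"
  have ne: "z - b \<noteq> 0" "z ^ p - b ^ p \<noteq> 0"
    using root_ne_center[OF z j] by (auto simp: b_def power_mult)
  have eq: "z ^ p - b ^ p = (z - b) * g"
    unfolding g_def by (rule power_diff_sumr2)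
  have "(\<Sum>i<p. b ^ (p - Suc i) / \<rho> ^ (p - 1) * z ^ i) = g / \<rho> ^ (p - 1)"
    by (simp add: g_def sum_divide_distrib)
  moreover have "\<rho> ^ p = \<rho> * \<rho> ^ (p - 1)"
    using p_gt_1 by (simp add: power_eq_if)
  moreover have "w z j = \<rho> / (z - b)" "y (z ^ p) j = \<rho> ^ p / (z ^ p - b ^ p)"
    using j by (auto simp: affinoid_coord_def b_def power_mult)
  ultimately show ?thesis
    using ne unfolding eq b_def[symmetric] by simp
qed

section \<open>Images of monomials as polynomials over \<open>K\<close>\<close>

definition tame :: "('k \<Rightarrow> 'k) \<Rightarrow> bool" where
  "tame u \<longleftrightarrow> (\<forall>i. (\<lambda>x. U_op p (\<lambda>z. z ^ i * u z) x) \<in> coord_polys K l S y)"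

lemma tame_cong:
  assumes "tame u" "\<And>z. z ^ p \<in> S \<Longrightarrow> v z = u z"
  shows "tame v"
  unfolding tame_def
proof
  fix i
  show "(\<lambda>x. U_op p (\<lambda>z. z ^ i * v z) x) \<in> coord_polys K l S y"
  proof (rule coord_polys_cong)
    show "(\<lambda>x. U_op p (\<lambda>z. z ^ i * u z) x) \<in> coord_polys K l S y"
      using assms(1) by (simp add: tame_def)
    show "U_op p (\<lambda>z. z ^ i * v z) x = U_op p (\<lambda>z. z ^ i * u z) x" if "x \<in> S" for x
      using p_gt_1 that assms(2) by (intro U_op_cong) auto
  qed (rule zero_mem)
qed

text \<open>By \<open>U_op_prime_monomial\<close> only powers of \<open>x\<close> and
  \<open>0\<close> arise, and \<open>x\<close> is a scalar multiple of the first new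
  coordinate.\<close>

lemma tame_1: "tame (\<lambda>z. 1)"
  unfolding tame_def
proof
  fix i
  have "(\<lambda>x. x ^ n) \<in> coord_polys K l S y" for n
  proof (rule coord_polys_cong)
    show "(\<lambda>x. (1 / \<rho> ^ p) ^ n * y x 1 ^ n) \<in> coord_polys K l S y"
      using l one_mem
      by (intro coord_polys_scale[OF coord_polys_coord_power] mult_mem power_mem divide_mem \<rho>_mem) auto
    show "x ^ n = (1 / \<rho> ^ p) ^ n * y x 1 ^ n" for x
      by (simp add: affinoid_coord_def flip: power_mult_distrib)
  qed (rule zero_mem)
  then show "(\<lambda>x. U_op p (\<lambda>z. z ^ i * 1) x) \<in> coord_polys K l S y"
    by (cases "p dvd i") (simp_all add: U_op_prime_monomial[OF prime_p] coord_polys.zero)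
qed

lemma tame_sum:
  assumes "\<And>i. i \<in> I \<Longrightarrow> tame (u i)"
  shows "tame (\<lambda>z. \<Sum>i\<in>I. u i z)"
  using assms unfolding tame_def sum_distrib_left U_op_sum
  by (auto intro: coord_polys_sum)

lemma tame_scale:
  assumes "tame u" "c \<in> K"
  shows "tame (\<lambda>z. c * u z)"
  unfolding tame_def
proof
  fix i
  have "(\<lambda>x. c * U_op p (\<lambda>z. z ^ i * u z) x) \<in> coord_polys K l S y"
    using assms by (intro coord_polys_scale[of _ K] mult_mem) (auto simp: tame_def)
  then show "(\<lambda>x. U_op p (\<lambda>z. z ^ i * (c * u z)) x) \<in> coord_polys K l S y"
    by (simp add: mult.left_commute[of _ c] U_op_const_mult)
qed

text \<open>This stability is why \<open>tame\<close> quantifies over all powers of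
  \<open>z\<close>: it lets \<open>coord_eq_polynomial\<close> be used to multiply by a
  coordinate.\<close>

lemma tame_mult_power: "tame u \<Longrightarrow> tame (\<lambda>z. z ^ n * u z)"
  by (simp add: tame_def flip: mult.assoc power_add)

text \<open>The projection formula: a function of \<open>z ^ p\<close> is constant on the fibre over
  \<open>x\<close>, so it can be taken out of the operator.\<close>

lemma tame_mult_new_coord:
  assumes "tame u" "j \<in> {1..l}"
  shows "tame (\<lambda>z. y (z ^ p) j * u z)"
  unfolding tame_def
proof
  fix i
  have "U_op p (\<lambda>z. z ^ i * (y (z ^ p) j * u z)) x = y x j * U_op p (\<lambda>z. z ^ i * u z) x" for x
    using p_gt_1 by (subst U_op_const_mult[symmetric], intro U_op_cong) auto
  then show "(\<lambda>x. U_op p (\<lambda>z. z ^ i * (y (z ^ p) j * u z)) x) \<in> coord_polys K l S y"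
    using assms by (simp add: tame_def coord_polys_mult_coord)
qed

lemma tame_mult_coord:
  assumes u: "tame u" and j: "j \<in> {1..l}"
  shows "tame (\<lambda>z. w z j * u z)"
proof (cases "j = 1")
  case True
  then show ?thesis
    using tame_scale[OF tame_mult_power[OF u, of 1] \<rho>_mem] by (simp add: affinoid_coord_def mult.assoc)
next
  case False
  then have j2: "j \<in> {2..l}"
    using j by auto
  let ?c = "\<lambda>i. (P j ^ s) ^ (p - Suc i) / \<rho> ^ (p - 1)"
  show ?thesis
  proof (rule tame_cong)
    show "tame (\<lambda>z. y (z ^ p) j * (\<Sum>i<p. ?c i * (z ^ i * u z)))"
      by (intro tame_mult_new_coord[OF _ j] tame_sum tame_scale tame_mult_power u
          divide_mem power_mem P_mem[OF j2] \<rho>_mem)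
    show "w z j * u z = y (z ^ p) j * (\<Sum>i<p. ?c i * (z ^ i * u z))" if "z ^ p \<in> S" for z
      by (subst coord_eq_polynomial[OF that j2]) (simp add: sum_distrib_right mult.assoc)
  qed
qed

lemma tame_coord_monomial: "tame (\<lambda>z. coord_monomial l (w z) \<nu>)"
proof -
  have power: "tame (\<lambda>z. w z j ^ n * u z)" if "tame u" "j \<in> {1..l}" for u j n
    by (induction n) (use that tame_mult_coord in \<open>auto simp: mult.assoc\<close>)
  have "J \<subseteq> {1..l} \<Longrightarrow> tame (\<lambda>z. \<Prod>j\<in>J. w z j ^ \<nu> j)" if "finite J" for J
    using that by induction (auto simp: tame_1 power)
  then show ?thesis
    by (simp add: coord_monomial_def)
qed

section \<open>A common denominator for the images of all monomials\<close>

definition clears_denominator :: "'k \<Rightarrow> (nat \<Rightarrow> nat) \<Rightarrow> bool" where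
  "clears_denominator a \<nu> \<longleftrightarrow>
     (\<lambda>x. a * U_op p (\<lambda>z. coord_monomial l (w z) \<nu>) x) \<in> coord_polys (valuation_ring K) l S y"

lemma clears_denominator_exists:
  obtains a where "a \<in> valuation_ring K" "a \<noteq> 0" "clears_denominator a \<nu>"
proof -
  have "(\<lambda>x. U_op p (\<lambda>z. coord_monomial l (w z) \<nu>) x) \<in> coord_polys K l S y"
    using tame_coord_monomial[of \<nu>] unfolding tame_def by (metis (no_types, lifting) ext mult_1 power_0)
  then show thesis
    using coord_polys_denominator that unfolding clears_denominator_def by blast
qed

lemma clears_denominator_mult:
  assumes "clears_denominator a \<nu>" "b \<in> valuation_ring K"
  shows "clears_denominator (b * a) \<nu>"
  using coord_polys_scale[OF assms(1)[unfolded clears_denominator_def], of b] assms(2) mult_mem_valuation_ring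
  by (simp add: clears_denominator_def mult.assoc)

lemma clears_denominator_finite:
  assumes "finite N"
  shows "\<exists>a \<in> valuation_ring K. a \<noteq> 0 \<and> (\<forall>\<nu>\<in>N. clears_denominator a \<nu>)"
  using assms
proof induction
  case empty
  show ?case
    using one_mem_valuation_ring by (intro bexI[of _ 1]) auto
next
  case (insert \<nu> N)
  then obtain a where a: "a \<in> valuation_ring K" "a \<noteq> 0" "\<forall>\<nu>\<in>N. clears_denominator a \<nu>"
    by blast
  obtain b where b: "b \<in> valuation_ring K" "b \<noteq> 0" "clears_denominator b \<nu>"
    by (rule clears_denominator_exists)
  have "clears_denominator (b * a) \<mu>" if "\<mu> \<in> insert \<nu> N" for \<mu>
    using that clears_denominator_mult[OF b(3) a(1)] clears_denominator_mult[OF _ b(1), of a \<mu>] a(3)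
    by (auto simp: mult.commute)
  then show ?case
    using a b mult_mem_valuation_ring by (intro bexI[of _ "b * a"]) auto
qed

text \<open>Multiplying \<open>coord_power_p\<close> by the monomial with \<open>j\<close>-th
  exponent \<open>\<nu> j - p\<close> expresses the given monomial by those with \<open>j\<close>-th
  exponents from \<open>\<nu> j - p\<close> to \<open>\<nu> j - 1\<close>. The coefficients are
  integral and the factor \<open>y\<close> is constant on fibres, so the same \<open>a\<close>
  works.\<close>

lemma clears_denominator_reduce:
  assumes j: "j \<in> {1..l}" and ge: "\<nu> j \<ge> p"
    and less: "\<And>n. n < \<nu> j \<Longrightarrow> clears_denominator a (\<nu>(j := n))"
  shows "clears_denominator a \<nu>"
proof -
  define \<mu> where "\<mu> = \<nu>(j := \<nu> j - p)"
  have \<nu>: "\<nu> = \<mu>(j := \<mu> j + p)"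
    using ge by (auto simp: \<mu>_def)
  have mon: "coord_monomial l (w z) \<nu>
      = y (z ^ p) j * (\<Sum>i\<in>{1..p}. root_coeff j i * coord_monomial l (w z) (\<nu>(j := \<nu> j - i)))"
    if "z ^ p \<in> S" for z
  proof -
    have "coord_monomial l (w z) \<nu> = w z j ^ p * coord_monomial l (w z) \<mu>"
      by (subst \<nu>) (rule coord_monomial_upd[OF j])
    also have "\<dots> = y (z ^ p) j *
        (\<Sum>i\<in>{1..p}. root_coeff j i * (w z j ^ (p - i) * coord_monomial l (w z) \<mu>))"
      unfolding coord_power_p[OF that j] by (simp add: sum_distrib_right mult.assoc)
    also have "(\<Sum>i\<in>{1..p}. root_coeff j i * (w z j ^ (p - i) * coord_monomial l (w z) \<mu>))
        = (\<Sum>i\<in>{1..p}. root_coeff j i * coord_monomial l (w z) (\<nu>(j := \<nu> j - i)))"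
    proof (intro sum.cong refl)
      fix i
      assume "i \<in> {1..p}"
      then have "\<nu>(j := \<nu> j - i) = \<mu>(j := \<mu> j + (p - i))"
        using ge by (auto simp: \<mu>_def)
      then show "root_coeff j i * (w z j ^ (p - i) * coord_monomial l (w z) \<mu>)
          = root_coeff j i * coord_monomial l (w z) (\<nu>(j := \<nu> j - i))"
        by (simp only: coord_monomial_upd[OF j])
    qed
    finally show ?thesis .
  qed
  have "(\<lambda>x. y x j * (\<Sum>i\<in>{1..p}. root_coeff j i *
      (a * U_op p (\<lambda>z. coord_monomial l (w z) (\<nu>(j := \<nu> j - i))) x)))
      \<in> coord_polys (valuation_ring K) l S y"
  proof (intro coord_polys_mult_coord[OF _ j] coord_polys_sum)
    fix i
    assume i: "i \<in> {1..p}"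
    then have "\<nu> j - i < \<nu> j"
      using ge p_gt_1 by auto
    from less[OF this] show "(\<lambda>x. root_coeff j i *
        (a * U_op p (\<lambda>z. coord_monomial l (w z) (\<nu>(j := \<nu> j - i))) x)) \<in> coord_polys (valuation_ring K) l S y"
      unfolding clears_denominator_def
      by (rule coord_polys_scale) (intro mult_mem_valuation_ring root_coeff_mem j i)
  qed
  moreover have "a * U_op p (\<lambda>z. coord_monomial l (w z) \<nu>) x = y x j * (\<Sum>i\<in>{1..p}. root_coeff j i *
      (a * U_op p (\<lambda>z. coord_monomial l (w z) (\<nu>(j := \<nu> j - i))) x))" if x: "x \<in> S" for x
  proof -
    have "U_op p (\<lambda>z. coord_monomial l (w z) \<nu>) x = U_op p (\<lambda>z. y x j *
        (\<Sum>i\<in>{1..p}. root_coeff j i * coord_monomial l (w z) (\<nu>(j := \<nu> j - i)))) x"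
      using p_gt_1 x mon by (intro U_op_cong) auto
    also have "\<dots> = y x j * (\<Sum>i\<in>{1..p}. root_coeff j i *
        U_op p (\<lambda>z. coord_monomial l (w z) (\<nu>(j := \<nu> j - i))) x)"
      by (simp add: U_op_const_mult U_op_sum)
    finally show ?thesis
      by (simp add: sum_distrib_left algebra_simps)
  qed
  ultimately show ?thesis
    unfolding clears_denominator_def by (rule coord_polys_cong[OF _ zero_mem_valuation_ring])
qed

text \<open>The monomials with all exponents below \<open>p\<close> are finitely many and share a
  denominator; \<open>clears_denominator_reduce\<close> carries it to all others. Independence of
  \<nu> is what keeps a null family of coefficients null.\<close>

lemma uniform_bound:
  obtains a where "a \<in> valuation_ring K" "a \<noteq> 0" "\<And>\<nu>. \<nu> \<in> multi_indices l \<Longrightarrow> clears_denominator a \<nu>"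
proof -
  obtain a where a: "a \<in> valuation_ring K" "a \<noteq> 0" "\<forall>\<nu>\<in>{1..l} \<rightarrow>\<^sub>E {..<p}. clears_denominator a \<nu>"
    using clears_denominator_finite[of "{1..l} \<rightarrow>\<^sub>E {..<p}"] by (auto intro: finite_PiE)
  have "clears_denominator a \<nu>" if "\<nu> \<in> multi_indices l" for \<nu>
    using that
  \<comment> \<open>Total degree serves all coordinates at once, as lowering any single exponent
    decreases it.\<close>
  proof (induction "\<Sum>j\<in>{1..l}. \<nu> j" arbitrary: \<nu> rule: less_induct)
    case less
    show ?case
    proof (cases "\<exists>j\<in>{1..l}. \<nu> j \<ge> p")
      case True
      then obtain j where j: "j \<in> {1..l}" "\<nu> j \<ge> p"
        by blast
      show ?thesis
      proof (rule clears_denominator_reduce[of j \<nu>, OF j])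
        fix n
        assume "n < \<nu> j"
        then have "(\<Sum>i\<in>{1..l}. (\<nu>(j := n)) i) < (\<Sum>i\<in>{1..l}. \<nu> i)"
          using j(1) by (intro sum_strict_mono_ex1) auto
        then show "clears_denominator a (\<nu>(j := n))"
          using less multi_indices_upd j(1) by blast
      qed
    next
      case False
      then have "\<nu> \<in> {1..l} \<rightarrow>\<^sub>E {..<p}"
        using less.prems by (auto simp: multi_indices_def PiE_iff not_le)
      then show ?thesis
        using a(3) by blast
    qed
  qed
  then show thesis
    using a that by blast
qed

lemma U_op_mem_rigid_functions:
  assumes c: "c \<in> tate_algebra K l"
    and \<xi>: "\<And>z. z \<in> affinoid l P (absv \<rho>) s \<Longrightarrow>
      ((\<lambda>\<nu>. c \<nu> * coord_monomial l (w z) \<nu>) has_sum \<xi> z) (multi_indices l)"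
  shows "U_op p \<xi> \<in> rigid_functions K l P (absv \<rho> ^ p) (s * p)"
proof -
  obtain a where a: "a \<in> valuation_ring K" "a \<noteq> 0" "\<And>\<nu>. \<nu> \<in> multi_indices l \<Longrightarrow> clears_denominator a \<nu>"
    by (rule uniform_bound) blast
  have "a \<in> K"
    using a(1) by (simp add: valuation_ring_def)
  define g where "g \<nu> x = a * U_op p (\<lambda>z. coord_monomial l (w z) \<nu>) x" for \<nu> x
  \<comment> \<open>The factor \<open>a\<close> is moved from the coefficients to the functions,
    which thereby become integral.\<close>
  have sum: "((\<lambda>\<nu>. c \<nu> / a * g \<nu> x) has_sum U_op p \<xi> x) (multi_indices l)" if "x \<in> S" for x
  proof -
    have "((\<lambda>\<nu>. U_op p (\<lambda>z. c \<nu> * coord_monomial l (w z) \<nu>) x) has_sum U_op p \<xi> x) (multi_indices l)"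
      using p_gt_1 that root_mem_affinoid by (intro U_op_has_sum \<xi>) auto
    then show ?thesis
      using a(2) by (simp add: g_def U_op_const_mult)
  qed
  have null: "finite {\<nu> \<in> multi_indices l. absv (c \<nu> / a) \<ge> e}" if "e > 0" for e
  proof -
    have "finite {\<nu> \<in> multi_indices l. absv (c \<nu>) \<ge> e * absv a}"
      using c a(2) that by (auto simp: tate_algebra_def)
    then show ?thesis
      using a(2) by (simp add: le_divide_eq)
  qed
  obtain d where d: "d \<in> tate_algebra K l"
    "\<And>x. x \<in> S \<Longrightarrow> ((\<lambda>\<mu>. d \<mu> * coord_monomial l (y x) \<mu>) has_sum U_op p \<xi> x) (multi_indices l)"
  proof (rule null_combination_of_coord_polys[OF closed_K _ null _ absv_coord_le_1 sum])
    show "c \<nu> / a \<in> K" if "\<nu> \<in> multi_indices l" for \<nu>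
      using that c \<open>a \<in> K\<close> by (intro divide_mem) (auto simp: tate_algebra_def)
    show "g \<nu> \<in> coord_polys (valuation_ring K) l S y" if "\<nu> \<in> multi_indices l" for \<nu>
      using a(3)[OF that] by (simp add: clears_denominator_def g_def[abs_def])
  qed blast+
  have "\<rho> ^ p \<in> K" "absv (\<rho> ^ p) = absv \<rho> ^ p"
    by (auto intro: power_mem \<rho>_mem)
  then show ?thesis
    using d unfolding rigid_functions_def coord_monomial_def by blast
qed

end

section \<open>The field of p-adic numbers\<close>

lemma nonarch_subfield_Qp: "nonarch_subfield (Qp :: 'k::nonarch_field set)"
proof
  show "0 \<in> (Qp :: 'k set)" "1 \<in> (Qp :: 'k set)"
    unfolding Qp_def using closure_subset[of "\<rat> :: 'k set"] by auto
  fix x :: 'k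
  assume "x \<in> Qp"
  then obtain f where f: "\<And>n. f n \<in> \<rat>" "f \<longlonglongrightarrow> x"
    unfolding Qp_def closure_sequential by blast
  show "- x \<in> Qp"
    unfolding Qp_def closure_sequential
    by (rule exI[of _ "\<lambda>n. - f n"]) (use f in \<open>auto intro: tendsto_minus\<close>)
  show "inverse x \<in> Qp"
  proof (cases "x = 0")
    case True
    then show ?thesis
      unfolding Qp_def using closure_subset[of "\<rat> :: 'k set"] by auto
  next
    case False
    then show ?thesis
      unfolding Qp_def closure_sequential
      by (intro exI[of _ "\<lambda>n. inverse (f n)"]) (use f in \<open>auto intro: tendsto_inverse_nonarch\<close>)
  qed
  fix y :: 'k
  assume "y \<in> Qp"
  then obtain g where g: "\<And>n. g n \<in> \<rat>" "g \<longlonglongrightarrow> y"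
    unfolding Qp_def closure_sequential by blast
  show "x + y \<in> Qp"
    unfolding Qp_def closure_sequential
    by (rule exI[of _ "\<lambda>n. f n + g n"]) (use f g in \<open>auto intro: tendsto_add\<close>)
  show "x * y \<in> Qp"
    unfolding Qp_def closure_sequential
    by (rule exI[of _ "\<lambda>n. f n * g n"]) (use f g in \<open>auto intro: tendsto_mult\<close>)
qed

lemma closed_Qp: "closed (Qp :: 'k::nonarch_field set)"
  by (simp add: Qp_def)

section \<open>Finite-dimensional spaces over a closed subfield\<close>

definition subspace_over :: "'k::nonarch_field set \<Rightarrow> 'k set \<Rightarrow> bool" where
  "subspace_over K E \<longleftrightarrow> 0 \<in> E \<and> (\<forall>x\<in>E. \<forall>y\<in>E. x + y \<in> E) \<and> (\<forall>c\<in>K. \<forall>x\<in>E. c * x \<in> E)"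

lemma subspace_over_diff:
  assumes "nonarch_subfield K" "subspace_over K E" "x \<in> E" "y \<in> E"
  shows "x - y \<in> E"
proof -
  have "-1 \<in> K"
    using assms(1) nonarch_subfield.minus_mem nonarch_subfield.one_mem by blast
  then have "x + (-1) * y \<in> E"
    using assms(2-) unfolding subspace_over_def by blast
  then show ?thesis
    by simp
qed

text \<open>A vector \<open>v\<close> outside the closed space \<open>E\<close> has positive
  distance \<delta> from it, so \<open>absv (k * v + e) \<ge> \<delta> * absv k\<close>. In a
  convergent sequence the coefficients of \<open>v\<close> are therefore Cauchy; their limit lies in
  \<open>K\<close>, and then the remaining parts converge in \<open>E\<close>.\<close>

lemma closed_line_extension:
  fixes K E :: "'k::nonarch_field set" and v :: 'k
  assumes K: "nonarch_subfield K" "closed K" and E: "subspace_over K E" "closed E"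
  defines "E' \<equiv> {k * v + e |k e. k \<in> K \<and> e \<in> E}"
  shows "subspace_over K E'" "closed E'"
proof -
  interpret nonarch_subfield K
    by (rule K)
  show "subspace_over K E'"
    unfolding subspace_over_def
  proof (intro conjI ballI)
    have "0 * v + 0 \<in> E'"
      using E(1) zero_mem unfolding E'_def subspace_over_def by blast
    then show "0 \<in> E'"
      by simp
    fix x
    assume "x \<in> E'"
    then obtain k e where x: "x = k * v + e" "k \<in> K" "e \<in> E"
      by (auto simp: E'_def)
    show "x + y \<in> E'" if y_mem: "y \<in> E'" for y
    proof -
      obtain k' e' where y: "y = k' * v + e'" "k' \<in> K" "e' \<in> E"
        using y_mem by (auto simp: E'_def)
      have "(k + k') * v + (e + e') \<in> E'"
        using x y E(1) add_mem unfolding E'_def subspace_over_def by blast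
      then show ?thesis
        using x y by (simp add: algebra_simps)
    qed
    show "c * x \<in> E'" if "c \<in> K" for c
    proof -
      have "(c * k) * v + c * e \<in> E'"
        using x that E(1) mult_mem unfolding E'_def subspace_over_def by blast
      then show ?thesis
        using x by (simp add: algebra_simps)
    qed
  qed
  show "closed E'"
  proof (cases "v \<in> E")
    case True
    have "E' = E"
    proof (intro equalityI subsetI)
      show "x \<in> E" if "x \<in> E'" for x
        using that True E(1) unfolding E'_def subspace_over_def by blast
      show "x \<in> E'" if "x \<in> E" for x
      proof -
        have "0 * v + x \<in> E'"
          using that zero_mem unfolding E'_def by blast
        then show ?thesis
          by simp
      qed
    qed
    then show ?thesis
      using E(2) by simp
  next
    case False
    then obtain \<delta> where \<delta>: "\<delta> > 0" "\<And>e. e \<in> E \<Longrightarrow> absv (v - e) \<ge> \<delta>"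
      using E(2) unfolding closed_def open_dist
      by (force simp: dist_absv absv_minus_commute not_less[symmetric])
    have gap: "\<delta> * absv k \<le> absv (k * v + e)" if "k \<in> K" "e \<in> E" for k e
    proof (cases "k = 0")
      case False
      have "- inverse k * e \<in> E"
        using that E(1) minus_mem[OF inverse_mem] unfolding subspace_over_def by blast
      from \<delta>(2)[OF this] have "\<delta> * absv k \<le> absv (v - - inverse k * e) * absv k"
        by (intro mult_right_mono) auto
      also have "\<dots> = absv (k * v + e)"
        using False by (simp add: field_simps flip: absv_mult)
      finally show ?thesis .
    qed simp
    show ?thesis
      unfolding closed_sequential_limits
    proof safe
      fix f x
      assume f: "\<forall>n. f n \<in> E'" "f \<longlonglongrightarrow> x"
      then have "\<exists>k e. f n = k * v + e \<and> k \<in> K \<and> e \<in> E" for n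
        by (auto simp: E'_def)
      then obtain k e where ke: "\<And>n. f n = k n * v + e n" "\<And>n. k n \<in> K" "\<And>n. e n \<in> E"
        by metis
      have "Cauchy k"
      proof (rule Cauchy_absvI)
        fix \<epsilon> :: real
        assume "\<epsilon> > 0"
        then have "\<epsilon> * \<delta> > 0"
          using \<delta>(1) by simp
        then obtain M where M: "\<And>m n. m \<ge> M \<Longrightarrow> n \<ge> M \<Longrightarrow> absv (f m - f n) < \<epsilon> * \<delta>"
          using LIMSEQ_imp_Cauchy[OF f(2)] unfolding Cauchy_def dist_absv by blast
        have "absv (k m - k n) < \<epsilon>" if "m \<ge> M" "n \<ge> M" for m n
        proof -
          have "\<delta> * absv (k m - k n) \<le> absv ((k m - k n) * v + (e m - e n))"
            using ke by (intro gap diff_mem subspace_over_diff[OF K(1) E(1)])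
          also have "\<dots> < \<epsilon> * \<delta>"
            using M[OF that] ke by (simp add: algebra_simps)
          finally show ?thesis
            using \<delta>(1) by (simp add: mult.commute)
        qed
        then show "\<exists>M. \<forall>m\<ge>M. \<forall>n\<ge>M. absv (k m - k n) < \<epsilon>"
          by blast
      qed
      then obtain k0 where k0: "k \<longlonglongrightarrow> k0"
        using Cauchy_convergent convergent_def by blast
      have "k0 \<in> K"
        using K(2) k0 ke(2) unfolding closed_sequential_limits by blast
      have "(\<lambda>n. f n - k n * v) \<longlonglongrightarrow> x - k0 * v"
        using f(2) k0 by (intro tendsto_intros)
      then have "e \<longlonglongrightarrow> x - k0 * v"
        using ke(1) by simp
      then have "x - k0 * v \<in> E"
        using E(2) ke(3) unfolding closed_sequential_limits by blast
      then have "k0 * v + (x - k0 * v) \<in> E'"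
        using \<open>k0 \<in> K\<close> unfolding E'_def by blast
      then show "x \<in> E'"
        by simp
    qed
  qed
qed

text \<open>A new term is either larger or smaller than the sum so far, and
  \<open>absv_add_eq\<close> selects the larger of the two. Only nonzero terms must have distinct
  absolute values, since zeros may repeat.\<close>

lemma absv_sum_distinct:
  fixes f :: "'i \<Rightarrow> 'k::nonarch_field"
  assumes "finite A" "A \<noteq> {}"
    and "\<And>i j. i \<in> A \<Longrightarrow> j \<in> A \<Longrightarrow> i \<noteq> j \<Longrightarrow> f i \<noteq> 0 \<Longrightarrow> absv (f i) \<noteq> absv (f j)"
  shows "\<exists>m\<in>A. absv (sum f A) = absv (f m) \<and> (\<forall>i\<in>A. absv (f i) \<le> absv (f m))"
  using assms
proof (induction A rule: finite_ne_induct)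
  case (insert k A)
  then obtain m where m: "m \<in> A" "absv (sum f A) = absv (f m)" "\<forall>i\<in>A. absv (f i) \<le> absv (f m)"
    by (metis insertCI)
  consider "absv (f k) < absv (f m)" | "absv (f m) < absv (f k)" | "f k = 0" "f m = 0"
    using insert.prems[of k m] insert.prems[of m k] insert.hyps m(1)
    by (metis absv_eq_0_iff insertCI linorder_cases)
  then show ?case
  proof cases
    case 1
    then show ?thesis
      using m insert.hyps absv_add_eq[of "f k" "sum f A"] by (auto simp: add.commute)
  next
    case 2
    then show ?thesis
      using m insert.hyps absv_add_eq[of "sum f A" "f k"] by auto
  next
    case 3
    then show ?thesis
      using m insert.hyps by auto
  qed
qed simp

section \<open>Values and residues of \<open>p\<close>-adic numbers\<close>

context
  fixes p :: nat
  assumes p: "Factorial_Ring.prime p" and absv_p: "absv (of_nat p :: 'k::nonarch_field) = 1 / real p"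
begin

text \<open>Both parts come from a Bezout relation \<open>n * u + p * v = 1\<close>, in which the
  second summand has absolute value below \<open>1\<close>.\<close>

lemma absv_int_unit:
  assumes "\<not> int p dvd n"
  shows "absv (of_int n :: 'k) = 1" "\<exists>m. absv (of_int (n * m - 1) :: 'k) < 1"
proof -
  have "coprime n (int p)"
    using assms p prime_imp_coprime_int[of "int p" n] by (simp add: coprime_commute[of n])
  then obtain u v where uv: "n * u + int p * v = 1"
    using bezout_int[of n "int p"] by (auto simp: coprime_iff_gcd_eq_1 mult.commute)
  have less: "absv (of_int (int p * v) :: 'k) < 1"
  proof -
    have "absv (of_int (int p * v) :: 'k) \<le> 1 / real p * 1"
      using absv_p by (simp add: absv_mult divide_right_mono)
    also have "\<dots> < 1"
      using prime_gt_1_nat[OF p] by simp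
    finally show ?thesis .
  qed
  have "n * u - 1 = - (int p * v)"
    using uv by simp
  then have "absv (of_int (n * u - 1) :: 'k) < 1"
    using less by (metis absv_minus of_int_minus)
  then show "\<exists>m. absv (of_int (n * m - 1) :: 'k) < 1"
    by blast
  have "absv (of_int (n * u) :: 'k) = 1"
  proof (rule ccontr)
    assume "\<not> ?thesis"
    then have "absv (of_int (n * u) :: 'k) < 1"
      using absv_of_int_le_1[where ?'k = 'k, of "n * u"] by linarith
    from absv_add_less[OF this less] show False
      using uv by (metis absv_1 less_irrefl of_int_1 of_int_add)
  qed
  moreover have "absv (of_int n :: 'k) * absv (of_int u :: 'k) \<le> absv (of_int n :: 'k)"
    by (intro mult_left_le) auto
  ultimately show "absv (of_int n :: 'k) = 1"
    using absv_of_int_le_1[where ?'k = 'k, of n] by (simp add: absv_mult)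
qed

lemma absv_of_int:
  assumes "n \<noteq> 0"
  shows "\<exists>k::nat. absv (of_int n :: 'k) = (1 / real p) ^ k"
proof -
  have "\<not> is_unit (int p)"
    using prime_gt_1_nat[OF p] by auto
  then obtain m where m: "n = int p ^ multiplicity (int p) n * m" "\<not> int p dvd m"
    using multiplicity_decompose'[OF assms] by blast
  then have "of_int n = (of_nat p :: 'k) ^ multiplicity (int p) n * of_int m"
    by (metis of_int_mult of_int_of_nat_eq of_int_power)
  then have "absv (of_int n :: 'k) = (1 / real p) ^ multiplicity (int p) n"
    using absv_int_unit(1)[OF m(2)] absv_p by (simp add: absv_mult)
  then show ?thesis
    by blast
qed

lemma Qp_approx:
  assumes "(x :: 'k) \<in> Qp" "e > 0"
  obtains a where "a \<in> \<rat>" "absv (x - a) < e"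
  using assms unfolding Qp_def closure_approachable by (metis absv_minus_commute dist_absv)

text \<open>A sufficiently close rational has the same absolute value as \<open>x\<close>, and
  nonzero rationals have integer powers of \<open>p\<close> as absolute values.\<close>

lemma log_absv_Qp:
  assumes "(x :: 'k) \<in> Qp" "x \<noteq> 0"
  shows "log (real p) (absv x) \<in> \<int>"
proof -
  obtain a where a: "a \<in> \<rat>" "absv (x - a) < absv x"
    using Qp_approx[OF assms(1), of "absv x"] assms(2) by auto
  then have eq: "absv a = absv x"
    using absv_add_eq[of "a - x" x] by (simp add: absv_minus_commute)
  obtain m n where mn: "a = of_int m / of_int n" "n \<noteq> 0"
    using a(1) by (auto elim: Rats_cases')
  then have "m \<noteq> 0"
    using eq assms(2) by force
  obtain i j where ij: "absv (of_int m :: 'k) = (1 / real p) ^ i" "absv (of_int n :: 'k) = (1 / real p) ^ j"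
    using absv_of_int \<open>m \<noteq> 0\<close> \<open>n \<noteq> 0\<close> by metis
  have "absv x = (1 / real p) ^ i / (1 / real p) ^ j"
    using ij mn eq by simp
  then have "log (real p) (absv x) = real j - real i"
    using prime_gt_1_nat[OF p] by (simp add: log_divide log_nat_power power_one_over)
  then show ?thesis
    by simp
qed

text \<open>The residue field of \<open>Qp\<close> is the prime field: \<open>x\<close> is close to
  an integral fraction in lowest terms, whose denominator is prime to \<open>p\<close> and can be
  inverted modulo \<open>p\<close>.\<close>

lemma Qp_residue:
  assumes "(x :: 'k) \<in> Qp" "absv x \<le> 1"
  obtains n :: int where "absv (x - of_int n) < 1"
proof -
  obtain a where a: "a \<in> \<rat>" "absv (x - a) < 1"
    using Qp_approx[OF assms(1), of 1] by auto
  have a1: "absv a \<le> 1"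
    using absv_add_le[of "a - x" 1 x] a(2) assms(2) by (simp add: absv_minus_commute)
  obtain m n where mn: "a = of_int m / of_int n" "n > 0" "coprime m n"
    using a(1) by (rule Rats_cases')
  have "\<not> int p dvd n"
  proof
    assume dvd: "int p dvd n"
    then have "\<not> int p dvd m"
      using mn(3) prime_gt_1_nat[OF p] by (metis coprime_common_divisor_int int_one_le_iff_zero_less less_irrefl
          not_prime_1 of_nat_less_iff zdvd1_eq abs_of_nat of_nat_1)
    obtain k where k: "n = int p * k"
      using dvd ..
    have "absv (of_int n :: 'k) \<le> 1 / real p"
      using absv_p absv_of_int_le_1[where ?'k = 'k, of k] by (simp add: k absv_mult divide_right_mono)
    also have "\<dots> < 1"
      using prime_gt_1_nat[OF p] by simp
    finally have "absv (of_int n :: 'k) < 1" "absv (of_int n :: 'k) > 0"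
      using mn(2) by auto
    then have "absv a > 1"
      using absv_int_unit(1)[OF \<open>\<not> int p dvd m\<close>] by (simp add: mn(1))
    then show False
      using a1 by simp
  qed
  then obtain k where k: "absv (of_int (n * k - 1) :: 'k) < 1" and n: "absv (of_int n :: 'k) = 1"
    using absv_int_unit by blast
  have "a - of_int (m * k) = - (a * of_int (n * k - 1))"
    using mn(1,2) by (simp add: field_simps)
  then have "absv (a - of_int (m * k)) = absv a * absv (of_int (n * k - 1) :: 'k)"
    by (simp only: absv_minus absv_mult)
  also have "\<dots> < 1"
    using k a1 by (smt (verit) absv_nonneg mult_left_le_one_le)
  finally have "absv (a - of_int (m * k)) < 1" .
  from absv_add_less[OF a(2) this] show thesis
    using that[of "m * k"] by simp
qed

end

section \<open>The cyclotomic field\<close>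

lemma field_ring_simps [simp]:
  "carrier field_ring = (UNIV :: 'k::nonarch_field set)"
  "x \<otimes>\<^bsub>field_ring\<^esub> y = x * (y :: 'k)"
  "x \<oplus>\<^bsub>field_ring\<^esub> y = x + (y :: 'k)"
  "\<one>\<^bsub>field_ring\<^esub> = (1 :: 'k)"
  "\<zero>\<^bsub>field_ring\<^esub> = (0 :: 'k)"
  by (simp_all add: ring_of_type_algebra_def)

lemma field_field_ring: "field (field_ring :: 'k::nonarch_field ring)"
  by (rule field_from_type_algebra)

lemma a_inv_field_ring [simp]: "\<ominus>\<^bsub>field_ring\<^esub> x = - (x :: 'k::nonarch_field)"
proof -
  interpret field "field_ring :: 'k ring"
    by (rule field_field_ring)
  show ?thesis
    using minus_equality[of "- x" x] by simp
qed

lemma m_inv_field_ring [simp]: "x \<noteq> 0 \<Longrightarrow> inv\<^bsub>field_ring\<^esub> x = inverse (x :: 'k::nonarch_field)"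
proof -
  interpret field "field_ring :: 'k ring"
    by (rule field_field_ring)
  show ?thesis if "x \<noteq> 0"
    using that comm_inv_char[of x "inverse x"] by simp
qed

lemma subfield_field_ring_iff:
  "subfield K (field_ring :: 'k::nonarch_field ring) \<longleftrightarrow> nonarch_subfield K"
proof -
  interpret field "field_ring :: 'k ring"
    by (rule field_field_ring)
  show ?thesis
  proof
    assume K: "subfield K field_ring"
    note ring = subringE[OF subfieldE(1)[OF K]]
    show "nonarch_subfield K"
    proof
      show "inverse x \<in> K" if "x \<in> K" for x
        using that ring(2) subfield_m_inv(1)[OF K, of x] by (cases "x = 0") (use ring in auto)
    qed (use ring in auto)
  next
    assume "nonarch_subfield K"
    then interpret K: nonarch_subfield K .
    show "subfield K field_ring"
      by (intro subfieldI' subringI)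
        (auto intro: K.one_mem K.minus_mem K.mult_mem K.add_mem K.inverse_mem)
  qed
qed

section \<open>Spans of powers over \<open>Qp\<close>\<close>

definition power_span :: "'k::nonarch_field \<Rightarrow> nat \<Rightarrow> 'k set" where
  "power_span \<pi> n = {\<Sum>i<n. a i * \<pi> ^ i |a. \<forall>i. a i \<in> Qp}"

lemma power_span_Suc: "power_span \<pi> (Suc n) = {k * \<pi> ^ n + e |k e. k \<in> Qp \<and> e \<in> power_span \<pi> n}"
proof (intro equalityI subsetI)
  fix x
  assume "x \<in> power_span \<pi> (Suc n)"
  then show "x \<in> {k * \<pi> ^ n + e |k e. k \<in> Qp \<and> e \<in> power_span \<pi> n}"
    unfolding power_span_def by (force simp: add.commute)
next
  fix x
  assume "x \<in> {k * \<pi> ^ n + e |k e. k \<in> Qp \<and> e \<in> power_span \<pi> n}"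
  then obtain k a where *: "x = k * \<pi> ^ n + (\<Sum>i<n. a i * \<pi> ^ i)" "k \<in> Qp" "\<forall>i. a i \<in> Qp"
    unfolding power_span_def by blast
  then have "x = (\<Sum>i<Suc n. (a(n := k)) i * \<pi> ^ i)"
    by simp
  moreover have "\<forall>i. (a(n := k)) i \<in> Qp"
    using * by simp
  ultimately show "x \<in> power_span \<pi> (Suc n)"
    unfolding power_span_def by blast
qed

lemma power_span_subspace_closed:
  "subspace_over Qp (power_span \<pi> n)" "closed (power_span \<pi> n)"
proof -
  have "subspace_over Qp (power_span \<pi> n) \<and> closed (power_span \<pi> n)"
  proof (induction n)
    case 0
    have "power_span \<pi> 0 = {0}"
      unfolding power_span_def using nonarch_subfield.zero_mem[OF nonarch_subfield_Qp] by auto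
    then show ?case
      by (simp add: subspace_over_def)
  next
    case (Suc n)
    then show ?case
      unfolding power_span_Suc
      using closed_line_extension[OF nonarch_subfield_Qp closed_Qp, of "power_span \<pi> n" "\<pi> ^ n"] by simp
  qed
  then show "subspace_over Qp (power_span \<pi> n)" "closed (power_span \<pi> n)"
    by auto
qed

lemma subspace_over_sum:
  "subspace_over K E \<Longrightarrow> (\<And>i. i \<in> I \<Longrightarrow> f i \<in> E) \<Longrightarrow> sum f I \<in> E"
  by (induction I rule: infinite_finite_induct) (auto simp: subspace_over_def)

lemma power_mem_power_span:
  fixes \<pi> :: "'k::nonarch_field"
  assumes "i < n"
  shows "\<pi> ^ i \<in> power_span \<pi> n"
proof -
  have "\<pi> ^ i = (\<Sum>j<n. (if j = i then 1 else 0) * \<pi> ^ j)"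
    using assms by (simp add: if_distrib[of "\<lambda>c. c * _"] cong: if_cong)
  moreover have "\<forall>j. (if j = i then 1 else 0) \<in> (Qp :: 'k set)"
  proof -
    interpret nonarch_subfield "Qp :: 'k set"
      by (rule nonarch_subfield_Qp)
    show ?thesis
      using zero_mem one_mem by simp
  qed
  ultimately show ?thesis
    unfolding power_span_def by (intro CollectI exI[of _ "\<lambda>j. if j = i then 1 else 0"]) simp
qed

section \<open>The uniformizer of the cyclotomic field\<close>

locale cyclotomic =
  fixes p :: nat and \<zeta> :: "'k::nonarch_field"
  assumes p: "Factorial_Ring.prime p" and absv_p: "absv (of_nat p :: 'k::nonarch_field) = 1 / real p"
    and \<zeta>: "\<zeta> ^ p = 1" "\<zeta> \<noteq> 1"
begin

definition \<pi> :: 'k where "\<pi> = \<zeta> - 1"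

lemma \<pi>_nonzero [simp]: "\<pi> \<noteq> 0"
  using \<zeta> by (simp add: \<pi>_def)

lemma p_gt_1: "p > 1"
  using p by (rule prime_gt_1_nat)

sublocale Qp: nonarch_subfield "Qp :: 'k set"
  by (rule nonarch_subfield_Qp)

text \<open>This is \<open>((1 + \<pi>) ^ p - 1) / \<pi>\<close>, an Eisenstein polynomial in
  \<pi>.\<close>

lemma \<pi>_equation: "(\<Sum>i\<in>{1..p}. of_nat (p choose i) * \<pi> ^ (i - 1)) = 0"
proof -
  have "0 = (\<Sum>i\<in>{1..p}. of_nat (p choose i) * \<pi> ^ i)"
    using power_diff_binomial[of 1 \<pi> p] \<zeta> by (simp add: \<pi>_def)
  also have "\<dots> = (\<Sum>i\<in>{1..p}. \<pi> * (of_nat (p choose i) * \<pi> ^ (i - 1)))"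
    by (intro sum.cong refl) (auto simp: power_eq_if)
  finally show ?thesis
    by (simp flip: sum_distrib_left)
qed

lemma \<pi>_power_eq: "\<pi> ^ (p - 1) = - (\<Sum>i\<in>{1..p - 1}. of_nat (p choose i) * \<pi> ^ (i - 1))"
proof -
  have "{1..p} = insert p {1..p - 1}"
    using p_gt_1 by auto
  then have "\<pi> ^ (p - 1) + (\<Sum>i\<in>{1..p - 1}. of_nat (p choose i) * \<pi> ^ (i - 1)) = 0"
    using \<pi>_equation p_gt_1 by simp
  then show ?thesis
    by (simp only: eq_neg_iff_add_eq_0)
qed

lemma absv_choose_le: "i \<in> {1..p - 1} \<Longrightarrow> absv (of_nat (p choose i) :: 'k) \<le> 1 / real p"
  using absv_prime_choose_le[OF p absv_p, of i] p_gt_1 by auto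

text \<open>If \<open>absv \<pi> \<ge> 1\<close>, every term on the right of
  \<open>\<pi>_power_eq\<close> is at most \<open>absv \<pi> ^ (p - 1) / p\<close>, too small for
  the sum to equal \<open>\<pi> ^ (p - 1)\<close>.\<close>

lemma absv_\<pi>_less_1: "absv \<pi> < 1"
proof (rule ccontr)
  assume "\<not> absv \<pi> < 1"
  then have ge: "absv \<pi> \<ge> 1"
    by simp
  have "absv (\<pi> ^ (p - 1)) \<le> 1 / real p * absv \<pi> ^ (p - 1)"
    unfolding \<pi>_power_eq absv_minus
  proof (rule absv_sum_le)
    fix i
    assume i: "i \<in> {1..p - 1}"
    show "absv (of_nat (p choose i) * \<pi> ^ (i - 1)) \<le> 1 / real p * absv \<pi> ^ (p - 1)"
      unfolding absv_mult absv_power using ge i absv_choose_le[OF i]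
      by (intro mult_mono power_increasing) auto
  qed simp
  also have "\<dots> < 1 * absv \<pi> ^ (p - 1)"
    using p_gt_1 by (intro mult_strict_right_mono) auto
  finally show False
    by simp
qed

text \<open>The term \<open>i = 1\<close> is \<open>p\<close> itself; every later one carries a
  factor \<open>p\<close> and a factor \<pi>, so \<open>p\<close> alone determines the absolute
  value.\<close>

lemma absv_\<pi>_power: "absv \<pi> ^ (p - 1) = 1 / real p"
proof -
  have "{1..p - 1} = insert 1 {2..p - 1}"
    using p_gt_1 by auto
  then have eq: "\<pi> ^ (p - 1) = - (of_nat p + (\<Sum>i\<in>{2..p - 1}. of_nat (p choose i) * \<pi> ^ (i - 1)))"
    using \<pi>_power_eq by simp
  have "absv (\<Sum>i\<in>{2..p - 1}. of_nat (p choose i) * \<pi> ^ (i - 1)) < 1 / real p"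
  proof (rule absv_sum_less)
    fix i
    assume i: "i \<in> {2..p - 1}"
    have "absv (of_nat (p choose i) * \<pi> ^ (i - 1)) \<le> 1 / real p * absv \<pi>"
      unfolding absv_mult absv_power using i absv_choose_le[of i] absv_\<pi>_less_1
        power_decreasing[of 1 "i - 1" "absv \<pi>"]
      by (intro mult_mono) auto
    also have "\<dots> < 1 / real p * 1"
      using absv_\<pi>_less_1 p_gt_1 by (intro mult_strict_left_mono) auto
    finally show "absv (of_nat (p choose i) * \<pi> ^ (i - 1)) < 1 / real p"
      by simp
  qed (use p_gt_1 in simp)
  then have "absv (\<pi> ^ (p - 1)) = absv (of_nat p :: 'k)"
    unfolding eq absv_minus by (intro absv_add_eq) (simp add: absv_p)
  then show ?thesis
    by (simp add: absv_p)
qed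

text \<open>Elements of \<open>Qp\<close> have integer powers of \<open>p\<close> as values, while
  \<pi> contributes multiples of \<open>1 / (p - 1)\<close> to the exponent. Equal values force
  \<open>i\<close> and \<open>j\<close> to be congruent modulo \<open>p - 1\<close>.\<close>

lemma absv_term_eq:
  assumes "a \<in> Qp" "b \<in> Qp" "a \<noteq> 0" "b \<noteq> 0" "i < p - 1" "j < p - 1"
    and eq: "absv (a * \<pi> ^ i) = absv (b * \<pi> ^ j)"
  shows "i = j"
proof -
  obtain A B where AB: "log (real p) (absv a) = of_int A" "log (real p) (absv b) = of_int B"
    using log_absv_Qp[OF p absv_p] assms by (metis Ints_cases)
  have "real (p - 1) * log (real p) (absv \<pi>) = log (real p) (absv \<pi> ^ (p - 1))"
    by (simp add: log_nat_power)
  also have "\<dots> = -1"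
    unfolding absv_\<pi>_power using p_gt_1 by (simp add: log_divide)
  finally have lp: "real (p - 1) * log (real p) (absv \<pi>) = -1" .
  have "log (real p) (absv (c * \<pi> ^ n)) = log (real p) (absv c) + real n * log (real p) (absv \<pi>)"
    if "c \<noteq> 0" for c n
    using that by (simp add: absv_mult log_mult log_nat_power)
  then have "of_int A + real i * log (real p) (absv \<pi>) = of_int B + real j * log (real p) (absv \<pi>)"
    using eq AB assms by metis
  then have "real (p - 1) * (of_int A + real i * log (real p) (absv \<pi>))
      = real (p - 1) * (of_int B + real j * log (real p) (absv \<pi>))"
    by simp
  then have "real (p - 1) * of_int A + real i * (real (p - 1) * log (real p) (absv \<pi>))
      = real (p - 1) * of_int B + real j * (real (p - 1) * log (real p) (absv \<pi>))"
    by (simp add: algebra_simps)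
  then have "real (p - 1) * of_int A - real i = real (p - 1) * of_int B - real j"
    unfolding lp by simp
  then have "real_of_int (int (p - 1) * A - int i) = real_of_int (int (p - 1) * B - int j)"
    by simp
  then have "int (p - 1) * A - int i = int (p - 1) * B - int j"
    by (simp only: of_int_eq_iff)
  then have "int i - int j = int (p - 1) * (A - B)"
    by (simp add: algebra_simps)
  then have "int i mod int (p - 1) = int j mod int (p - 1)"
    by (simp add: mod_eq_dvd_iff)
  then show ?thesis
    using assms by simp
qed

section \<open>The field spanned by powers of the uniformizer\<close>

definition M :: "'k set" where "M = power_span \<pi> (p - 1)"

lemma M_subspace: "subspace_over Qp M" and closed_M: "closed M"
  by (simp_all add: M_def power_span_subspace_closed)

lemma Qp_subset_M: "Qp \<subseteq> M"
proof
  fix x :: 'k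
  assume "x \<in> Qp"
  moreover have "\<pi> ^ 0 \<in> M"
    unfolding M_def using p_gt_1 by (intro power_mem_power_span) auto
  ultimately have "x * \<pi> ^ 0 \<in> M"
    using M_subspace unfolding subspace_over_def by blast
  then show "x \<in> M"
    by simp
qed

text \<open>Only the top power leaves the range of exponents, and \<open>\<pi>_power_eq\<close>
  rewrites it in lower ones.\<close>

lemma \<pi>_mult_mem_M:
  assumes "x \<in> M"
  shows "\<pi> * x \<in> M"
proof -
  have pow: "\<pi> ^ Suc i \<in> M" if "i < p - 1" for i
  proof (cases "Suc i < p - 1")
    case True
    then show ?thesis
      by (simp add: M_def power_mem_power_span del: power_Suc)
  next
    case False
    then have "Suc i = p - 1"
      using that by simp
    moreover have "- (\<Sum>i\<in>{1..p - 1}. of_nat (p choose i) * \<pi> ^ (i - 1))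
        = (\<Sum>i\<in>{1..p - 1}. - of_nat (p choose i) * \<pi> ^ (i - 1))"
      by (simp add: sum_negf)
    moreover have "\<dots> \<in> M"
      using M_subspace
    proof (rule subspace_over_sum)
      fix i
      assume "i \<in> {1..p - 1}"
      then have "\<pi> ^ (i - 1) \<in> M"
        by (auto simp: M_def intro: power_mem_power_span)
      then show "- of_nat (p choose i) * \<pi> ^ (i - 1) \<in> M"
        using M_subspace Qp.minus_mem[OF Qp.of_nat_mem] unfolding subspace_over_def by blast
    qed
    ultimately show ?thesis
      by (simp only: \<pi>_power_eq)
  qed
  obtain a where a: "x = (\<Sum>i<p - 1. a i * \<pi> ^ i)" "\<forall>i. a i \<in> Qp"
    using assms unfolding M_def power_span_def by blast
  have "\<pi> * x = (\<Sum>i<p - 1. a i * \<pi> ^ Suc i)"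
    by (simp add: a(1) sum_distrib_left mult.left_commute)
  also have "\<dots> \<in> M"
    using M_subspace pow a(2) unfolding subspace_over_def
    by (intro subspace_over_sum[OF M_subspace]) auto
  finally show ?thesis .
qed

lemma mult_mem_M:
  assumes "x \<in> M" "y \<in> M"
  shows "x * y \<in> M"
proof -
  have pow: "\<pi> ^ i * x \<in> M" for i
    by (induction i) (use assms(1) \<pi>_mult_mem_M in \<open>auto simp: mult.assoc\<close>)
  obtain a where a: "y = (\<Sum>i<p - 1. a i * \<pi> ^ i)" "\<forall>i. a i \<in> Qp"
    using assms(2) unfolding M_def power_span_def by blast
  have "x * y = (\<Sum>i<p - 1. a i * (\<pi> ^ i * x))"
    by (simp add: a(1) sum_distrib_left mult_ac)
  also have "\<dots> \<in> M"
    using M_subspace pow a(2) unfolding subspace_over_def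
    by (intro subspace_over_sum[OF M_subspace]) auto
  finally show ?thesis .
qed

text \<open>Splitting off the term \<open>i = 1\<close> of \<open>\<pi>_equation\<close> gives
  \<open>p + \<pi> * g = 0\<close>, so the inverse is \<open>- g / p\<close>.\<close>

lemma inverse_\<pi>_mem_M: "inverse \<pi> \<in> M"
proof -
  define g where "g = (\<Sum>i\<in>{2..p}. of_nat (p choose i) * \<pi> ^ (i - 2))"
  have g: "g \<in> M"
    unfolding g_def
  proof (rule subspace_over_sum[OF M_subspace])
    fix i
    assume "i \<in> {2..p}"
    then have "\<pi> ^ (i - 2) \<in> M"
      unfolding M_def by (intro power_mem_power_span) auto
    then show "of_nat (p choose i) * \<pi> ^ (i - 2) \<in> M"
      using M_subspace Qp.of_nat_mem unfolding subspace_over_def by blast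
  qed
  have "{1..p} = insert 1 {2..p}"
    using p_gt_1 by auto
  moreover have "\<pi> * g = (\<Sum>i\<in>{2..p}. of_nat (p choose i) * \<pi> ^ (i - 1))"
    unfolding g_def sum_distrib_left
  proof (intro sum.cong refl)
    fix i
    assume "i \<in> {2..p}"
    then have "i - 1 = Suc (i - 2)"
      by auto
    then show "\<pi> * (of_nat (p choose i) * \<pi> ^ (i - 2)) = of_nat (p choose i) * \<pi> ^ (i - 1)"
      by simp
  qed
  ultimately have "of_nat p + \<pi> * g = 0"
    using \<pi>_equation by simp
  then have "\<pi> * (- (1 / of_nat p) * g) = 1"
    using p_gt_1 by (simp add: field_simps add_eq_0_iff)
  then have "inverse \<pi> = - (1 / of_nat p) * g"
    by (rule inverse_unique)
  moreover have "- (1 / of_nat p :: 'k) \<in> Qp"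
    by (intro Qp.minus_mem Qp.divide_mem Qp.one_mem Qp.of_nat_mem)
  ultimately show ?thesis
    using g M_subspace unfolding subspace_over_def by metis
qed

text \<open>By \<open>absv_term_eq\<close> nonzero terms have distinct absolute values, so the
  largest one determines \<open>absv x\<close> and is strictly larger than the rest when
  \<open>x \<noteq> 0\<close>.\<close>

lemma M_dominant_term:
  assumes "x \<in> M"
  obtains a m where "x = (\<Sum>i<p - 1. a i * \<pi> ^ i)" "\<And>i. a i \<in> Qp" "m < p - 1"
    "absv x = absv (a m * \<pi> ^ m)"
    "\<And>i. i < p - 1 \<Longrightarrow> i \<noteq> m \<Longrightarrow> x \<noteq> 0 \<Longrightarrow> absv (a i * \<pi> ^ i) < absv x"
proof -
  obtain a where a: "x = (\<Sum>i<p - 1. a i * \<pi> ^ i)" "\<And>i. a i \<in> Qp"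
    using assms unfolding M_def power_span_def by blast
  have distinct: "absv (a i * \<pi> ^ i) \<noteq> absv (a j * \<pi> ^ j)"
    if "i < p - 1" "j < p - 1" "i \<noteq> j" "a i * \<pi> ^ i \<noteq> 0" for i j
  proof
    assume eq: "absv (a i * \<pi> ^ i) = absv (a j * \<pi> ^ j)"
    then have "absv (a j * \<pi> ^ j) \<noteq> 0"
      using that(4) by (metis absv_eq_0_iff)
    then show False
      using absv_term_eq[OF a(2) a(2) _ _ that(1,2) eq] that by auto
  qed
  have "{..<p - 1} \<noteq> {}"
    using p_gt_1 by (simp add: lessThan_empty_iff)
  then obtain m where m: "m < p - 1" "absv x = absv (a m * \<pi> ^ m)"
    "\<forall>i<p - 1. absv (a i * \<pi> ^ i) \<le> absv (a m * \<pi> ^ m)"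
    using absv_sum_distinct[of "{..<p - 1}" "\<lambda>i. a i * \<pi> ^ i"] distinct
    unfolding a(1) by (auto simp: Bex_def)
  have "absv (a i * \<pi> ^ i) < absv x" if "i < p - 1" "i \<noteq> m" "x \<noteq> 0" for i
    using distinct[of m i] that m by (metis absv_eq_0_iff order_le_neq_trans)
  then show thesis
    using that a m by blast
qed

text \<open>The partial sums of the geometric series in \<open>- u\<close> stay in \<open>M\<close>,
  which is closed.\<close>

lemma inverse_one_plus_mem_M:
  assumes "u \<in> M" "absv u < 1"
  shows "inverse (1 + u) \<in> M"
proof -
  have ne: "1 + u \<noteq> 0"
    using assms(2) by (metis absv_1 absv_minus add_eq_0_iff less_irrefl)
  have one: "1 \<in> M"
    using Qp_subset_M Qp.one_mem by blast
  have "- u \<in> M"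
    using subspace_over_diff[OF nonarch_subfield_Qp M_subspace _ assms(1), of 0] M_subspace
    by (simp add: subspace_over_def)
  then have pow: "(- u) ^ n \<in> M" for n
    by (induction n) (simp_all only: power_0 power_Suc one mult_mem_M)
  have "(\<lambda>n. absv u ^ n) \<longlonglongrightarrow> 0"
    using assms(2) by (intro LIMSEQ_realpow_zero) auto
  then have lim: "(\<lambda>n. (- u) ^ n) \<longlonglongrightarrow> 0"
    by (simp add: tendsto_absv_diff_0)
  have "(\<Sum>i<n. (- u) ^ i) = (1 - (- u) ^ n) * inverse (1 + u)" for n
    using ne one_diff_power_eq[of "- u" n] by (simp add: field_simps)
  moreover have "(\<lambda>n. (1 - (- u) ^ n) * inverse (1 + u)) \<longlonglongrightarrow> (1 - 0) * inverse (1 + u)"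
    using lim by (intro tendsto_intros)
  ultimately have "(\<lambda>n. \<Sum>i<n. (- u) ^ i) \<longlonglongrightarrow> inverse (1 + u)"
    by simp
  moreover have "(\<Sum>i<n. (- u) ^ i) \<in> M" for n
    by (intro subspace_over_sum[OF M_subspace] pow)
  ultimately show ?thesis
    by (rule closed_sequentially[OF closed_M, rotated])
qed

text \<open>A nonzero element is its dominant term times \<open>1 + u\<close> with \<open>absv u < 1\<close>; a geometric series
  inverts \<open>1 + u\<close>.\<close>

lemma nonarch_subfield_M: "nonarch_subfield M"
proof
  show "0 \<in> M" "1 \<in> M"
    using Qp_subset_M Qp.zero_mem Qp.one_mem by auto
  fix x
  assume x: "x \<in> M"
  show "x + y \<in> M" if "y \<in> M" for y
    using that x M_subspace unfolding subspace_over_def by blast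
  show "- x \<in> M"
    using subspace_over_diff[OF nonarch_subfield_Qp M_subspace _ x, of 0] M_subspace
    by (simp add: subspace_over_def)
  show "x * y \<in> M" if "y \<in> M" for y
    using x that by (rule mult_mem_M)
  show "inverse x \<in> M"
  proof (cases "x = 0")
    case True
    then show ?thesis
      using Qp_subset_M Qp.zero_mem by auto
  next
    case False
    from x obtain a m where a: "x = (\<Sum>i<p - 1. a i * \<pi> ^ i)" "\<And>i. a i \<in> Qp" "m < p - 1"
      "absv x = absv (a m * \<pi> ^ m)"
      "\<And>i. i < p - 1 \<Longrightarrow> i \<noteq> m \<Longrightarrow> x \<noteq> 0 \<Longrightarrow> absv (a i * \<pi> ^ i) < absv x"
      by (rule M_dominant_term) blast
    define t where "t = a m * \<pi> ^ m"
    have t: "t \<noteq> 0" "absv t = absv x"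
      using False a(4) by (auto simp: t_def simp flip: absv_eq_0_iff)
    have "x - t = (\<Sum>i\<in>{..<p - 1} - {m}. a i * \<pi> ^ i)"
      using a(1,3) by (simp add: t_def sum.remove[of _ m])
    also have "absv \<dots> < absv t"
      using a(5) False t by (intro absv_sum_less) auto
    finally have "absv ((x - t) / t) < 1"
      using t(1) by (simp add: divide_less_eq)
    moreover have "(x - t) / t = x * inverse t - 1"
      using t(1) by (simp add: field_simps)
    ultimately have "absv (x * inverse t - 1) < 1"
      by simp
    moreover have "inverse t \<in> M"
    proof -
      have "inverse \<pi> ^ n \<in> M" for n
        by (induction n) (use Qp_subset_M Qp.one_mem inverse_\<pi>_mem_M mult_mem_M in auto)
      then have "inverse (a m) * inverse \<pi> ^ m \<in> M"
        using Qp_subset_M Qp.inverse_mem[OF a(2)] by (intro mult_mem_M) auto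
      then show ?thesis
        by (simp add: t_def power_inverse)
    qed
    moreover from this have "x * inverse t - 1 \<in> M"
      using mult_mem_M[OF x] Qp_subset_M Qp.one_mem
      by (intro subspace_over_diff[OF nonarch_subfield_Qp M_subspace]) auto
    ultimately have "inverse (1 + (x * inverse t - 1)) \<in> M"
      by (intro inverse_one_plus_mem_M)
    then have "inverse t * inverse (x * inverse t) \<in> M"
      using \<open>inverse t \<in> M\<close> mult_mem_M by simp
    moreover have "inverse t * inverse (x * inverse t) = inverse x"
      using t(1) by (simp add: inverse_mult_distrib)
    ultimately show ?thesis
      by metis
  qed
qed

text \<open>Total ramification: no term with \<open>i > 0\<close> has absolute value
  \<open>1\<close>, so \<open>x\<close> is congruent to the term \<open>a 0\<close> in
  \<open>Qp\<close>, and that to an integer.\<close>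

lemma M_residue:
  assumes "x \<in> M" "absv x \<le> 1"
  obtains n :: int where "absv (x - of_int n) < 1"
proof -
  from assms(1) obtain a m where a: "x = (\<Sum>i<p - 1. a i * \<pi> ^ i)" "\<And>i. a i \<in> Qp" "m < p - 1"
    "absv x = absv (a m * \<pi> ^ m)"
    "\<And>i. i < p - 1 \<Longrightarrow> i \<noteq> m \<Longrightarrow> x \<noteq> 0 \<Longrightarrow> absv (a i * \<pi> ^ i) < absv x"
    by (rule M_dominant_term) blast
  show thesis
  proof (cases "x = 0")
    case True
    then show ?thesis
      using that[of 0] by simp
  next
    case False
    have le: "absv (a i * \<pi> ^ i) \<le> 1" if "i < p - 1" for i
      using a(4) a(5)[OF that] False assms(2) by (cases "i = m") auto
    have less: "absv (a i * \<pi> ^ i) < 1" if "i \<in> {..<p - 1} - {0}" for i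
    proof (rule ccontr)
      assume "\<not> ?thesis"
      then have eq: "absv (a i * \<pi> ^ i) = 1"
        using le[of i] that by auto
      then have "a i \<noteq> 0"
        by auto
      then have "i = 0"
        \<comment> \<open>Value \<open>1\<close> is also the value of \<open>1 * \<pi> ^ 0\<close>,
          so the exponents must agree.\<close>
        using absv_term_eq[OF a(2) Qp.one_mem, of i i 0] eq that p_gt_1 by auto
      then show False
        using that by simp
    qed
    have "x - a 0 = (\<Sum>i\<in>{..<p - 1} - {0}. a i * \<pi> ^ i)"
      using a(1) p_gt_1 by (simp add: sum.remove[of _ 0])
    also have "absv \<dots> < 1"
      by (intro absv_sum_less less) auto
    finally have 1: "absv (x - a 0) < 1" .
    have "absv (a 0) \<le> 1"
      using le[of 0] p_gt_1 by simp
    then obtain n where 2: "absv (a 0 - of_int n) < 1"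
      using Qp_residue[OF p absv_p a(2)] by blast
    show ?thesis
      using that[of n] absv_add_less[OF 1 2] by simp
  qed
qed

text \<open>The first \<open>p\<close> powers of \<zeta> are distinct and there are only
  \<open>p\<close> roots, so adjoining all of them amounts to adjoining \<zeta>.\<close>

lemma roots_of_unity_eq: "{z. z ^ p = 1} = (\<lambda>i. \<zeta> ^ i) ` {..<p}"
proof (rule card_subset_eq[symmetric])
  have "inj_on (\<lambda>i. \<zeta> ^ i) {..<p}"
  proof (rule linorder_inj_onI')
    fix i j
    assume ij: "i \<in> {..<p}" "j \<in> {..<p}" "i < j"
    show "\<zeta> ^ i \<noteq> \<zeta> ^ j"
    proof
      assume "\<zeta> ^ i = \<zeta> ^ j"
      moreover have "\<zeta> ^ j = \<zeta> ^ i * \<zeta> ^ (j - i)"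
        using ij by (simp flip: power_add)
      moreover have "\<zeta> \<noteq> 0"
        using \<zeta> p_gt_1 by (auto simp: power_0_left)
      ultimately have "\<zeta> ^ (j - i) = 1"
        by simp
      moreover have "\<not> p dvd j - i"
        using ij by (auto dest: dvd_imp_le)
      ultimately show False
        using prime_root_of_unity_power_eq_1[OF p \<zeta>(1)] \<zeta>(2) by blast
    qed
  qed
  then show "card ((\<lambda>i. \<zeta> ^ i) ` {..<p}) = card {z :: 'k. z ^ p = 1}"
    using p_gt_1 by (simp add: card_image card_nth_roots_alg_closed)
  show "(\<lambda>i. \<zeta> ^ i) ` {..<p} \<subseteq> {z. z ^ p = 1}"
    using \<zeta>(1) by (auto simp: power_mult[symmetric] mult.commute[of _ p]) (simp add: power_mult)
  show "finite {z :: 'k. z ^ p = 1}"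
    using p_gt_1 by (intro finite_nth_roots) auto
qed

text \<open>\<open>M\<close> is a subfield containing the generators, and its elements are
  polynomials over \<open>Qp\<close> in \<pi>. This transfers closedness and the residues to the
  cyclotomic field.\<close>

lemma Omega1_eq_M: "Omega1 p = M"
proof -
  interpret R: field "field_ring :: 'k ring"
    by (rule field_field_ring)
  interpret M: nonarch_subfield M
    by (rule nonarch_subfield_M)
  let ?H = "Qp \<union> {\<zeta> :: 'k. \<zeta> ^ p = 1 \<and> \<zeta> \<noteq> 1}"
  have sub: "subfield (Omega1 p :: 'k set) field_ring"
    unfolding Omega1_def by (rule R.generate_field_is_subfield) simp
  interpret O: nonarch_subfield "Omega1 p :: 'k set"
    using sub by (simp add: subfield_field_ring_iff)
  have "\<zeta> \<in> M"
  proof -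
    have "\<pi> * 1 \<in> M"
      by (intro \<pi>_mult_mem_M M.one_mem)
    from M.add_mem[OF M.one_mem this] show ?thesis
      by (simp add: \<pi>_def)
  qed
  then have "{z. z ^ p = 1} \<subseteq> M"
    unfolding roots_of_unity_eq using M.power_mem by auto
  then have "?H \<subseteq> M"
    using Qp_subset_M by auto
  then have "Omega1 p \<subseteq> M"
    unfolding Omega1_def
    by (intro R.generate_field_min_subfield1) (simp_all add: subfield_field_ring_iff nonarch_subfield_M)
  moreover have "M \<subseteq> Omega1 p"
  proof
    have H: "?H \<subseteq> Omega1 p"
      unfolding Omega1_def by (intro subsetI generate_field.incl)
    then have "\<zeta> \<in> Omega1 p"
      using \<zeta> by blast
    then have "\<pi> \<in> Omega1 p"
      unfolding \<pi>_def by (intro O.diff_mem O.one_mem)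
    fix x
    assume "x \<in> M"
    then obtain a where a: "x = (\<Sum>i<p - 1. a i * \<pi> ^ i)" "\<forall>i. a i \<in> Qp"
      unfolding M_def power_span_def by blast
    show "x \<in> Omega1 p"
      unfolding a(1) using a(2) H \<open>\<pi> \<in> Omega1 p\<close>
      by (intro O.sum_mem O.mult_mem O.power_mem) auto
  qed
  ultimately show ?thesis
    by blast
qed

end

lemma Omega1_properties:
  assumes "Factorial_Ring.prime p" "absv (of_nat p :: 'k::nonarch_field) = 1 / real p"
  shows nonarch_subfield_Omega1: "nonarch_subfield (Omega1 p :: 'k set)"
    and closed_Omega1: "closed (Omega1 p :: 'k set)"
    and Omega1_residue: "(x :: 'k) \<in> Omega1 p \<Longrightarrow> absv x \<le> 1 \<Longrightarrow> \<exists>n::int. absv (x - of_int n) < 1"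
proof -
  have p: "p > 1"
    using assms(1) by (rule prime_gt_1_nat)
  then have "card {\<zeta> :: 'k. \<zeta> ^ p = 1} = p"
    by (intro card_nth_roots_alg_closed) auto
  then have "{\<zeta> :: 'k. \<zeta> ^ p = 1} \<noteq> {1}"
    using p by force
  then obtain \<zeta> :: 'k where "\<zeta> ^ p = 1" "\<zeta> \<noteq> 1"
    by auto
  then interpret cyclotomic p \<zeta>
    using assms by unfold_locales
  show "nonarch_subfield (Omega1 p :: 'k set)" "closed (Omega1 p :: 'k set)"
    using nonarch_subfield_M closed_M by (simp_all add: Omega1_eq_M)
  show "\<exists>n::int. absv (x - of_int n) < 1" if "x \<in> Omega1 p" "absv x \<le> 1" for x :: 'k
    using M_residue[of x] that by (auto simp: Omega1_eq_M)
qed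

section \<open>Residue fields and Teichmueller lifts\<close>

text \<open>Dimension is built up by line extensions, each of which preserves closedness by
  \<open>closed_line_extension\<close>.\<close>

lemma closed_finite_dimension:
  assumes K: "nonarch_subfield K" "closed K" and dim: "ring.dimension field_ring n K E"
  shows "closed (E :: 'k::nonarch_field set)"
proof -
  interpret field "field_ring :: 'k ring"
    by (rule field_field_ring)
  have "subspace_over K E \<and> closed E"
    using dim K
  proof (induction rule: dimension.induct)
    case (zero_dim K)
    then show ?case
      by (simp add: subspace_over_def)
  next
    case (Suc_dim v E n K)
    have "line_extension K v E = {k * v + e |k e. k \<in> K \<and> e \<in> E}"
      unfolding set_eq_iff line_extension_mem_iff field_ring_simps by blast
    then show ?case
      using Suc_dim closed_line_extension[of K E v] by simp
  qed
  then show ?thesis ..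
qed

text \<open>Coordinates with respect to a basis give a bijection with the lists of length
  \<open>n\<close> over \<open>K\<close>.\<close>

lemma (in ring) card_dimension:
  assumes "subfield K R" "finite K" "dimension n K E"
  shows "finite E" "card E = card K ^ n"
proof -
  obtain Vs where Vs: "set Vs \<subseteq> carrier R" "independent K Vs" "length Vs = n" "Span K Vs = E"
    using exists_base[OF assms(1,3)] by blast
  have "bij_betw (\<lambda>Ks. combine Ks Vs) {Ks. set Ks \<subseteq> K \<and> length Ks = n} E"
    unfolding bij_betw_def
  proof
    show img: "(\<lambda>Ks. combine Ks Vs) ` {Ks. set Ks \<subseteq> K \<and> length Ks = n} = E"
      unfolding Vs(4)[symmetric] Span_eq_combine_set_length_version[OF assms(1) Vs(1)]
      using Vs(3) by auto
    show "inj_on (\<lambda>Ks. combine Ks Vs) {Ks. set Ks \<subseteq> K \<and> length Ks = n}"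
    proof (rule inj_onI)
      fix Ks Ls
      assume Ks: "Ks \<in> {Ks. set Ks \<subseteq> K \<and> length Ks = n}"
        and Ls: "Ls \<in> {Ks. set Ks \<subseteq> K \<and> length Ks = n}"
        and eq: "combine Ks Vs = combine Ls Vs"
      have "combine Ks Vs \<in> Span K Vs"
        unfolding Vs(4) using img Ks by blast
      then have "\<exists>!Ms. set Ms \<subseteq> K \<and> length Ms = length Vs \<and> combine Ks Vs = combine Ms Vs"
        by (rule unique_decomposition[OF assms(1) Vs(2)])
      then obtain Ms where Ms: "\<And>Ns. set Ns \<subseteq> K \<Longrightarrow> length Ns = length Vs \<Longrightarrow>
          combine Ks Vs = combine Ns Vs \<Longrightarrow> Ns = Ms"
        by (elim ex1E) metis
      show "Ks = Ls"
        using Ms[of Ks] Ms[of Ls] Ks Ls eq Vs(3) by simp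
    qed
  qed
  then show "finite E" "card E = card K ^ n"
    using finite_lists_length_eq[OF assms(2), of n] card_lists_length_eq[OF assms(2), of n]
    by (auto simp: bij_betw_finite dest: bij_betw_same_card)
qed

text \<open>For nonzero \<open>x\<close> this is Lagrange's theorem in the multiplicative
  group.\<close>

lemma (in field) pow_card_carrier:
  assumes "finite (carrier R)" "x \<in> carrier R"
  shows "x [^] card (carrier R) = x"
proof -
  have "card (carrier R) > 0"
    using assms card_gt_0_iff by blast
  then obtain n where n: "card (carrier R) = Suc n"
    by (cases "card (carrier R)") auto
  show ?thesis
  proof (cases "x = \<zero>")
    case True
    then show ?thesis
      unfolding n by simp
  next
    case False
    interpret mult: group "Multiplicative_Group.mult_of R"
      by (rule field_mult_group)
    have "order (Multiplicative_Group.mult_of R) = n"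
      using order_mult_of[OF assms(1)] n by (simp add: order_def)
    then have "x [^] n = \<one>"
      using mult.pow_order_eq_1[of x] False assms(2) by (simp add: Multiplicative_Group.nat_pow_mult_of)
    then show ?thesis
      using assms(2) by (simp add: n)
  qed
qed

section \<open>Valuation rings and their residue fields\<close>

abbreviation valuation_ring_of :: "'k::nonarch_field set \<Rightarrow> 'k ring" where
  "valuation_ring_of L \<equiv> field_ring\<lparr>carrier := valuation_ring L\<rparr>"

abbreviation residue_class :: "'k::nonarch_field set \<Rightarrow> 'k \<Rightarrow> 'k set" where
  "residue_class L x \<equiv> valuation_ideal L +>\<^bsub>valuation_ring_of L\<^esub> x"

context nonarch_subfield
begin

lemma cring_valuation_ring_of: "cring (valuation_ring_of K)"
proof -
  interpret field "field_ring :: 'k ring"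
    by (rule field_field_ring)
  have "subring (valuation_ring K) field_ring"
    by (rule subringI) (auto intro: one_mem_valuation_ring minus_mem_valuation_ring
        mult_mem_valuation_ring add_mem_valuation_ring)
  then show ?thesis
    using subcring_iff[of "valuation_ring K"] subcringI' by auto
qed

text \<open>An integral element outside the ideal has absolute value \<open>1\<close>, so its
  inverse is integral too and any larger ideal contains \<open>1\<close>.\<close>

lemma maximalideal_valuation_ideal: "maximalideal (valuation_ideal K) (valuation_ring_of K)"
proof -
  interpret V: cring "valuation_ring_of K"
    by (rule cring_valuation_ring_of)
  have absorb: "x * y \<in> valuation_ideal K" if "x \<in> valuation_ideal K" "y \<in> valuation_ring K" for x y
  proof -
    have "absv x * absv y \<le> absv x"
      using that by (intro mult_left_le) (auto simp: valuation_ring_def)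
    then show ?thesis
      using that mult_mem by (auto simp: valuation_ideal_def valuation_ring_def absv_mult)
  qed
  have ideal: "ideal (valuation_ideal K) (valuation_ring_of K)"
  proof (rule idealI)
    show "subgroup (valuation_ideal K) (add_monoid (valuation_ring_of K))"
    proof (rule V.add.subgroupI)
      show "\<ominus>\<^bsub>valuation_ring_of K\<^esub> x \<in> valuation_ideal K" if "x \<in> valuation_ideal K" for x
      proof -
        have "x \<in> valuation_ring K" "- x \<in> valuation_ring K"
          using that minus_mem by (auto simp: valuation_ideal_def valuation_ring_def)
        then have "\<ominus>\<^bsub>valuation_ring_of K\<^esub> x = - x"
          using V.minus_equality[of "- x" x] by simp
        then show ?thesis
          using that minus_mem by (simp add: valuation_ideal_def)
      qed
    qed (auto simp: valuation_ideal_def valuation_ring_def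
        intro: add_mem absv_add_less exI[of _ 0] zero_mem)
  qed (use absorb in \<open>auto simp: V.ring_axioms mult.commute\<close>)
  show ?thesis
  proof (rule maximalidealI[OF ideal])
    have "1 \<in> valuation_ring K" "1 \<notin> valuation_ideal K"
      by (auto simp: one_mem_valuation_ring valuation_ideal_def)
    then show "carrier (valuation_ring_of K) \<noteq> valuation_ideal K"
      by auto
    fix J
    assume J: "ideal J (valuation_ring_of K)" "valuation_ideal K \<subseteq> J" "J \<subseteq> carrier (valuation_ring_of K)"
    interpret J: ideal J "valuation_ring_of K"
      by (rule J)
    show "J = valuation_ideal K \<or> J = carrier (valuation_ring_of K)"
    proof (rule disjCI)
      assume "J \<noteq> carrier (valuation_ring_of K)"
      then have "1 \<notin> J"
        using J.one_imp_carrier by auto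
      have "x \<in> valuation_ideal K" if "x \<in> J" for x
      proof (rule ccontr)
        assume "x \<notin> valuation_ideal K"
        then have x: "x \<in> K" "absv x = 1"
          using J(3) that by (auto simp: valuation_ring_def valuation_ideal_def)
        then have "inverse x \<in> valuation_ring K"
          by (simp add: valuation_ring_def inverse_mem)
        then have "inverse x * x \<in> J"
          using J.I_l_closed[OF that, of "inverse x"] by simp
        moreover have "x \<noteq> 0"
          using x by auto
        ultimately show False
          using \<open>1 \<notin> J\<close> by simp
      qed
      then show "J = valuation_ideal K"
        using J(2) by blast
    qed
  qed
qed

lemma field_residue_field: "field (residue_field K)"
  unfolding residue_field_def
  by (rule maximalideal.quotient_is_field[OF maximalideal_valuation_ideal cring_valuation_ring_of])

lemma carrier_residue_field: "carrier (residue_field K) = residue_class K ` valuation_ring K"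
  by (auto simp: residue_field_def FactRing_def A_RCOSETS_def')

lemma residue_class_hom: "residue_class K \<in> ring_hom (valuation_ring_of K) (residue_field K)"
  unfolding residue_field_def using maximalideal.axioms(1)[OF maximalideal_valuation_ideal]
  by (rule ideal.rcos_ring_hom)

lemma residue_class_simps:
  assumes "x \<in> valuation_ring K" "y \<in> valuation_ring K"
  shows "residue_class K x \<otimes>\<^bsub>residue_field K\<^esub> residue_class K y = residue_class K (x * y)"
    "residue_class K x \<oplus>\<^bsub>residue_field K\<^esub> residue_class K y = residue_class K (x + y)"
  using ring_hom_mult[OF residue_class_hom, of x y] ring_hom_add[OF residue_class_hom, of x y] assms
  by simp_all

lemma residue_class_1: "\<one>\<^bsub>residue_field K\<^esub> = residue_class K 1"
  using ring_hom_one[OF residue_class_hom] by simp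

text \<open>Here \<open>x\<close> and \<open>y\<close> range over the whole ambient field, so the
  criterion includes \<open>x - y \<in> K\<close>.\<close>

lemma residue_class_eq_iff:
  "residue_class K x = residue_class K y \<longleftrightarrow> x - y \<in> K \<and> absv (x - y) < 1"
proof
  have C: "residue_class K x = (\<lambda>h. h + x) ` valuation_ideal K" for x
    by (auto simp: a_r_coset_def')
  assume "residue_class K x = residue_class K y"
  moreover have "0 + x \<in> residue_class K x"
    unfolding C by (intro imageI) (simp add: valuation_ideal_def zero_mem)
  ultimately show "x - y \<in> K \<and> absv (x - y) < 1"
    unfolding C by (auto simp: valuation_ideal_def)
next
  have C: "residue_class K x = (\<lambda>h. h + x) ` valuation_ideal K" for x
    by (auto simp: a_r_coset_def')
  assume *: "x - y \<in> K \<and> absv (x - y) < 1"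
  have "h + x \<in> (\<lambda>h. h + y) ` valuation_ideal K" if "h \<in> valuation_ideal K" for h
    using * that by (intro image_eqI[of _ _ "h + (x - y)"])
      (auto simp: valuation_ideal_def intro: add_mem absv_add_less)
  moreover have "h + y \<in> (\<lambda>h. h + x) ` valuation_ideal K" if "h \<in> valuation_ideal K" for h
    using * that by (intro image_eqI[of _ _ "h - (x - y)"])
      (auto simp: valuation_ideal_def intro: diff_mem absv_diff_less)
  ultimately show "residue_class K x = residue_class K y"
    unfolding C by blast
qed

lemma residue_class_0: "\<zero>\<^bsub>residue_field K\<^esub> = residue_class K 0"
proof -
  have "\<zero>\<^bsub>residue_field K\<^esub> = valuation_ideal K"
    by (simp add: residue_field_def FactRing_def)
  also have "\<dots> = residue_class K 0"
    by (auto simp: a_r_coset_def')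
  finally show ?thesis .
qed

lemma residue_class_power:
  assumes "x \<in> valuation_ring K"
  shows "residue_class K x [^]\<^bsub>residue_field K\<^esub> (n :: nat) = residue_class K (x ^ n)"
proof (induction n)
  case 0
  then show ?case
    by (simp add: residue_class_1)
next
  case (Suc n)
  have "x ^ n \<in> valuation_ring K"
    by (induction n) (auto intro: assms one_mem_valuation_ring mult_mem_valuation_ring)
  then show ?case
    using Suc assms by (simp add: residue_class_simps mult.commute)
qed

text \<open>A nonzero class is represented by an element of \<open>F\<close> of absolute value
  \<open>1\<close>, and the class of its inverse is the inverse class.\<close>

lemma subfield_residue_subfield:
  assumes F: "nonarch_subfield F" "F \<subseteq> K"
  shows "subfield (residue_subfield F K) (residue_field K)"
proof -
  interpret F: nonarch_subfield F
    by (rule F)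
  interpret R: field "residue_field K"
    by (rule field_residue_field)
  have sub: "valuation_ring F \<subseteq> valuation_ring K"
    using F(2) by (auto simp: valuation_ring_def)
  have mem: "residue_class K x \<in> carrier (residue_field K)" if "x \<in> valuation_ring K" for x
    using that by (auto simp: carrier_residue_field)
  show ?thesis
  proof (rule R.subfieldI')
    show "subring (residue_subfield F K) (residue_field K)"
    proof (rule R.subringI)
      show "residue_subfield F K \<subseteq> carrier (residue_field K)"
        using mem sub by (auto simp: residue_subfield_def)
      show "\<one>\<^bsub>residue_field K\<^esub> \<in> residue_subfield F K"
        using F.one_mem_valuation_ring by (auto simp: residue_subfield_def residue_class_1)
      fix C
      assume "C \<in> residue_subfield F K"
      then obtain x where x: "C = residue_class K x" "x \<in> valuation_ring F"
        by (auto simp: residue_subfield_def)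
      have "- x \<in> valuation_ring F"
        using x(2) by (rule F.minus_mem_valuation_ring)
      moreover have "residue_class K (- x) \<oplus>\<^bsub>residue_field K\<^esub> C = \<zero>\<^bsub>residue_field K\<^esub>"
        using x calculation sub by (simp add: subsetD residue_class_simps(2) residue_class_0)
      ultimately show "\<ominus>\<^bsub>residue_field K\<^esub> C \<in> residue_subfield F K"
        using R.minus_equality[of "residue_class K (- x)" C] x sub mem
        by (auto simp: residue_subfield_def)
      fix D
      assume "D \<in> residue_subfield F K"
      then obtain y where y: "D = residue_class K y" "y \<in> valuation_ring F"
        by (auto simp: residue_subfield_def)
      have xy: "x \<in> valuation_ring K" "y \<in> valuation_ring K"
        using x y sub by auto
      show "C \<otimes>\<^bsub>residue_field K\<^esub> D \<in> residue_subfield F K"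
        "C \<oplus>\<^bsub>residue_field K\<^esub> D \<in> residue_subfield F K"
        using x y F.mult_mem_valuation_ring F.add_mem_valuation_ring
        by (auto simp: residue_subfield_def residue_class_simps[OF xy])
    qed
    fix C
    assume "C \<in> residue_subfield F K - {\<zero>\<^bsub>residue_field K\<^esub>}"
    then obtain x where x: "C = residue_class K x" "x \<in> valuation_ring F"
      and ne: "residue_class K x \<noteq> residue_class K 0"
      by (auto simp: residue_subfield_def residue_class_0)
    have "absv x = 1"
      using ne x(2) F(2) unfolding residue_class_eq_iff by (auto simp: valuation_ring_def)
    then have inv: "inverse x \<in> valuation_ring F"
      using x(2) by (simp add: valuation_ring_def F.inverse_mem)
    have "x \<noteq> 0"
      using \<open>absv x = 1\<close> by auto
    then have "C \<otimes>\<^bsub>residue_field K\<^esub> residue_class K (inverse x) = \<one>\<^bsub>residue_field K\<^esub>"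
      using x inv sub by (simp add: subsetD residue_class_simps residue_class_1)
    then have "inv\<^bsub>residue_field K\<^esub> C = residue_class K (inverse x)"
      using x inv sub mem by (intro R.comm_inv_char) auto
    then show "inv\<^bsub>residue_field K\<^esub> C \<in> residue_subfield F K"
      using inv by (simp add: residue_subfield_def)
  qed
qed

end

text \<open>Over the algebraically closed ambient field \<open>X ^ n - X\<close> splits into linear
  factors. Were every root at distance at least \<open>1\<close> from \<open>x\<close>, the product
  would have absolute value at least \<open>1\<close>. The root need not yet lie in the subfield of
  interest.\<close>

lemma root_near:
  fixes x :: "'k::nonarch_field"
  assumes "n > 1" "absv (x ^ n - x) < 1"
  obtains t where "t ^ n = t" "absv (x - t) < 1"
proof -
  define f :: "'k poly" where "f = Polynomial.monom 1 n - Polynomial.monom 1 1"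
  have "Polynomial.degree f = n"
    unfolding f_def using assms(1)
    by (intro antisym degree_le le_degree) auto
  moreover from this have "f \<noteq> 0"
    using assms(1) by auto
  moreover have "Polynomial.coeff f n = 1"
    using assms(1) by (simp add: f_def)
  ultimately obtain A where f: "f = (\<Prod>a\<in>#A. [:-a, 1:])"
    using alg_closed_imp_factorization[of f] by auto
  have "\<exists>t\<in>#A. absv (x - t) < 1"
  proof (rule ccontr)
    assume "\<not> ?thesis"
    then have "absv (poly (\<Prod>a\<in>#A. [:-a, 1:]) x) \<ge> 1"
    proof (induction A)
      case (add a A)
      then have "absv (x - a) * absv (poly (\<Prod>a\<in>#A. [:-a, 1:]) x) \<ge> 1 * 1"
        by (intro mult_mono) auto
      moreover have "poly (\<Prod>a\<in>#add_mset a A. [:-a, 1:]) x = (x - a) * poly (\<Prod>a\<in>#A. [:-a, 1:]) x"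
        by (simp add: algebra_simps)
      ultimately show ?case
        by (simp only: absv_mult)
    qed simp
    then show False
      using assms(2) by (simp flip: f) (simp add: f_def poly_monom)
  qed
  then obtain t where t: "t \<in># A" "absv (x - t) < 1"
    by blast
  have "poly f t = 0"
    unfolding f using t(1) by (simp add: poly_prod_mset prod_mset_zero_iff image_iff)
  then have "t ^ n = t"
    by (simp add: f_def poly_monom)
  then show thesis
    using t(2) by (rule that)
qed

lemma absv_fixed_power_le_1:
  assumes "t ^ n = (t :: 'k::nonarch_field)" "n > 1"
  shows "absv t \<le> 1"
proof (rule ccontr)
  assume "\<not> ?thesis"
  then have "absv t ^ 1 < absv t ^ n"
    using assms(2) by (intro power_strict_increasing) auto
  then show False
    using assms(1) by (metis absv_power less_irrefl power_one_right)
qed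

section \<open>Fixed points of the \<open>q\<close>-th power map\<close>

context
  fixes p :: nat
  assumes p: "Factorial_Ring.prime p" and absv_p: "absv (of_nat p :: 'k::nonarch_field) = 1 / real p"
begin

text \<open>Integral elements of \<open>Omega1 p\<close> are congruent to integers, hence to one of
  \<open>0, ..., p - 1\<close>; these are incongruent because differences prime to \<open>p\<close>
  have absolute value \<open>1\<close>.\<close>

lemma card_residue_subfield_Omega1:
  assumes L: "nonarch_subfield L" "Omega1 p \<subseteq> (L :: 'k set)"
  shows "finite (residue_subfield (Omega1 p) L)" "card (residue_subfield (Omega1 p) L) = p"
proof -
  interpret L: nonarch_subfield L
    by (rule L)
  interpret O: nonarch_subfield "Omega1 p :: 'k set"
    by (rule nonarch_subfield_Omega1[OF p absv_p])
  have p1: "p > 1"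
    using p by (rule prime_gt_1_nat)
  have "residue_subfield (Omega1 p) L = (\<lambda>i. residue_class L (of_nat i)) ` {..<p}"
  proof (intro equalityI subsetI)
    fix C
    assume "C \<in> residue_subfield (Omega1 p) L"
    then obtain x where x: "C = residue_class L x" "x \<in> Omega1 p" "absv x \<le> 1"
      by (auto simp: residue_subfield_def valuation_ring_def)
    obtain n :: int where n: "absv (x - of_int n) < 1"
      using Omega1_residue[OF p absv_p x(2,3)] by blast
    define i where "i = nat (n mod int p)"
    have i: "i < p" "n = int i + int p * (n div int p)"
      using p1 by (auto simp: i_def nat_less_iff)
    have "absv (of_int (int p * (n div int p)) :: 'k) \<le> 1 / real p * 1"
      using absv_p by (simp add: absv_mult divide_right_mono)
    also have "\<dots> < 1"
      using p1 by simp
    finally have "absv (of_int (int p * (n div int p)) :: 'k) < 1" .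
    from absv_add_less[OF n this] have "absv (x - of_nat i) < 1"
      using arg_cong[OF i(2), of "of_int :: int \<Rightarrow> 'k"] by (simp del: of_int_mult)
    moreover have "x - of_nat i \<in> L"
      using x L(2) by (intro L.diff_mem L.of_nat_mem) auto
    ultimately have "C = residue_class L (of_nat i)"
      by (simp add: x L.residue_class_eq_iff)
    then show "C \<in> (\<lambda>i. residue_class L (of_nat i)) ` {..<p}"
      using i by auto
  qed (auto simp: residue_subfield_def valuation_ring_def O.of_nat_mem)
  moreover have "inj_on (\<lambda>i. residue_class L (of_nat i)) {..<p}"
  proof (rule linorder_inj_onI')
    fix i j
    assume ij: "i \<in> {..<p}" "j \<in> {..<p}" "i < j"
    then have "\<not> int p dvd int i - int j"
      by (auto dest!: zdvd_imp_le[of "int p" "int j - int i"] simp: dvd_diff_commute[of _ "int i"])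
    from absv_int_unit(1)[OF p absv_p this]
    show "residue_class L (of_nat i) \<noteq> residue_class L (of_nat j)"
      by (simp add: L.residue_class_eq_iff)
  qed
  ultimately show "finite (residue_subfield (Omega1 p) L)" "card (residue_subfield (Omega1 p) L) = p"
    by (simp_all add: card_image)
qed

text \<open>Taking \<open>p\<close>-th powers contracts small distances: the term
  \<open>h ^ p\<close> is at most \<open>absv h ^ 2\<close>, and the other terms gain a factor
  \<open>1 / p\<close>. Both \<open>absv h\<close> and \<open>1 / p\<close> are bounded by
  \<open>c\<close>.\<close>

lemma absv_power_diff_le:
  assumes "absv (h :: 'k) \<le> c" "c < 1" "1 / real p \<le> c" "absv b \<le> 1"
  shows "absv ((b + h) ^ p - b ^ p) \<le> c * absv h"
  unfolding power_diff_binomial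
proof (rule absv_sum_le)
  have p1: "p > 1"
    using p by (rule prime_gt_1_nat)
  fix i
  assume i: "i \<in> {1..p}"
  have h1: "absv h \<le> 1"
    using assms by simp
  have "absv (of_nat (p choose i) :: 'k) * absv h ^ i \<le> c * absv h"
  proof (cases "i = p")
    case True
    have "absv h ^ p = absv h ^ (p - 1) * absv h"
      using p1 by (simp add: power_eq_if)
    also have "\<dots> \<le> absv h ^ 1 * absv h"
      using p1 h1 by (intro mult_right_mono power_decreasing) auto
    also have "\<dots> \<le> c * absv h"
      using assms(1) by (intro mult_right_mono) auto
    finally show ?thesis
      using True by simp
  next
    case False
    have "absv (of_nat (p choose i) :: 'k) * absv h ^ i \<le> 1 / real p * absv h ^ 1"
      using absv_prime_choose_le[OF p absv_p, of i] i False h1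
      by (intro mult_mono power_decreasing) auto
    also have "\<dots> \<le> c * absv h"
      using mult_right_mono[OF assms(3), of "absv h"] by simp
    finally show ?thesis .
  qed
  moreover have "absv (b ^ (p - i)) \<le> 1"
    using assms(4) by (simp add: power_le_one)
  ultimately show "absv (of_nat (p choose i) * h ^ i * b ^ (p - i)) \<le> c * absv h"
    unfolding absv_mult absv_power[of h] by (smt (verit) absv_nonneg mult_left_le mult_nonneg_nonneg zero_le_power)
next
  have "0 \<le> c"
    using assms(1) absv_nonneg[of h] by linarith
  then show "0 \<le> c * absv h"
    by simp
qed

text \<open>The powers \<open>x ^ p ^ (a * n)\<close> lie in \<open>L\<close> and approach
  \<open>t ^ p ^ (a * n) = t\<close> by repeated contraction, so \<open>t\<close> belongs to the
  closed set \<open>L\<close>.\<close>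

lemma teichmueller_mem:
  assumes L: "nonarch_subfield L" "closed L" and x: "x \<in> L" and a: "a \<ge> 1"
    and t: "t ^ (p ^ a) = t" "absv (x - t :: 'k) < 1"
  shows "t \<in> L"
proof -
  interpret L: nonarch_subfield L
    by (rule L)
  have p1: "p > 1"
    using p by (rule prime_gt_1_nat)
  have t1: "absv t \<le> 1"
    using t(1) p1 a one_less_power[of p a] by (intro absv_fixed_power_le_1[of _ "p ^ a"]) auto
  \<comment> \<open>With this maximum the same contraction factor below \<open>1\<close> serves at
    every iterate.\<close>
  define c where "c = max (1 / real p) (absv (x - t))"
  have c: "c \<ge> 0" "c < 1" "1 / real p \<le> c" "absv (x - t) \<le> c"
    using t(2) p1 by (auto simp: c_def less_max_iff_disj le_max_iff_disj)
  have le: "absv (x ^ p ^ n - t ^ p ^ n) \<le> c ^ n * absv (x - t)" for n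
  proof (induction n)
    case (Suc n)
    have "c ^ n * absv (x - t) \<le> 1 * absv (x - t)"
      using c by (intro mult_right_mono) (auto simp: power_le_one)
    then have "absv (x ^ p ^ n - t ^ p ^ n) \<le> c"
      using Suc c by linarith
    moreover have "absv (t ^ p ^ n) \<le> 1"
      using t1 by (simp add: power_le_one)
    ultimately have "absv ((t ^ p ^ n + (x ^ p ^ n - t ^ p ^ n)) ^ p - (t ^ p ^ n) ^ p)
        \<le> c * absv (x ^ p ^ n - t ^ p ^ n)"
      using c by (intro absv_power_diff_le) auto
    also have "\<dots> \<le> c * (c ^ n * absv (x - t))"
      using Suc c by (intro mult_left_mono) auto
    finally show ?case
      by (simp add: mult.commute[of p] mult.assoc flip: power_mult)
  qed simp
  have fix_t: "t ^ p ^ (a * n) = t" for n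
    by (induction n) (simp_all add: power_add power_mult t(1))
  have "(\<lambda>n. x ^ p ^ (a * n)) \<longlonglongrightarrow> t"
    unfolding tendsto_absv_diff_0
  proof (rule tendsto_sandwich[OF _ _ tendsto_const])
    show "(\<lambda>n. c ^ n) \<longlonglongrightarrow> 0"
      using c by (intro LIMSEQ_realpow_zero)
    have "absv (x ^ p ^ (a * n) - t) \<le> c ^ n" for n
    proof -
      have "absv (x ^ p ^ (a * n) - t) \<le> c ^ (a * n) * absv (x - t)"
        using le[of "a * n"] by (simp add: fix_t)
      \<comment> \<open>Since \<open>a \<ge> 1\<close>, the exponent \<open>a * n\<close> is at
        least \<open>n\<close>.\<close>
      also have "\<dots> \<le> c ^ n * 1"
        using c t(2) a by (intro mult_mono power_decreasing) auto
      finally show ?thesis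
        by simp
    qed
    then show "\<forall>\<^sub>F n in sequentially. absv (x ^ p ^ (a * n) - t) \<le> c ^ n"
      by simp
  qed simp
  then show ?thesis
    using closed_sequentially[OF L(2), of "\<lambda>n. x ^ p ^ (a * n)"] L.power_mem[OF x] by blast
qed

text \<open>A count: the residue field of \<open>L\<close> has \<open>q\<close> elements and each
  class contains a fixed point in \<open>L\<close>, while \<open>X ^ q - X\<close> has at most
  \<open>q\<close> roots. So lifts defined through another unramified field also lie in
  \<open>L\<close>, without comparing the two fields.\<close>

lemma fixed_points_mem_unramified:
  assumes unr: "unramified_extension (Omega1 p) L a" and a: "a \<ge> 1" and t: "t ^ (p ^ a) = (t :: 'k)"
  shows "t \<in> L"
proof -
  define q where "q = p ^ a"
  have q: "q > 1"
    using prime_gt_1_nat[OF p] a one_less_power[of p a] by (simp add: q_def)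
  have L: "nonarch_subfield L" "Omega1 p \<subseteq> L"
    and dim: "ring.dimension field_ring a (Omega1 p) L"
    and rdim: "ring.dimension (residue_field L) a (residue_subfield (Omega1 p) L) (carrier (residue_field L))"
    using unr by (auto simp: unramified_extension_def subfield_field_ring_iff)
  have closed: "closed L"
    using closed_finite_dimension[OF nonarch_subfield_Omega1[OF p absv_p] closed_Omega1[OF p absv_p] dim] .
  interpret L: nonarch_subfield L
    by (rule L)
  interpret R: field "residue_field L"
    by (rule L.field_residue_field)
  have R: "finite (carrier (residue_field L))" "card (carrier (residue_field L)) = q"
    using R.card_dimension[OF L.subfield_residue_subfield[OF nonarch_subfield_Omega1[OF p absv_p] L(2)] _ rdim]
      card_residue_subfield_Omega1[OF L] by (auto simp: q_def)
  let ?T = "{t :: 'k. t ^ q = t}"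
  have fin: "finite ?T" and card: "card ?T \<le> q"
  proof -
    let ?f = "Polynomial.monom 1 q - Polynomial.monom 1 1 :: 'k poly"
    have "Polynomial.degree ?f = q"
      using q by (intro antisym degree_le le_degree) auto
    moreover from this have "?f \<noteq> 0"
      using q by (simp add: monom_eq_iff')
    moreover have "?T = {t. poly ?f t = 0}"
      by (auto simp: poly_monom)
    ultimately show "finite ?T" "card ?T \<le> q"
      using poly_roots_finite[of ?f] card_poly_roots_bound[of ?f] by auto
  qed
  have "carrier (residue_field L) \<subseteq> residue_class L ` (?T \<inter> L)"
  proof
    fix C
    assume C: "C \<in> carrier (residue_field L)"
    then obtain x where x: "C = residue_class L x" "x \<in> valuation_ring L"
      by (auto simp: L.carrier_residue_field)
    \<comment> \<open>Every element of a field with \<open>q\<close> elements equals its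
      \<open>q\<close>-th power; this supplies the hypothesis of \<open>root_near\<close>.\<close>
    have "residue_class L (x ^ q) = residue_class L x"
      using R.pow_card_carrier[OF R(1) C] x R(2) by (simp add: L.residue_class_power)
    then have "absv (x ^ q - x) < 1"
      by (simp add: L.residue_class_eq_iff)
    then obtain t where t: "t ^ q = t" "absv (x - t) < 1"
      using root_near[OF q] by blast
    have "x \<in> L"
      using x(2) by (simp add: valuation_ring_def)
    then have "t \<in> L"
      using teichmueller_mem[OF L(1) closed _ a] t by (simp add: q_def)
    then have "C = residue_class L t"
      using t(2) \<open>x \<in> L\<close> by (simp add: x(1) L.residue_class_eq_iff L.diff_mem)
    then show "C \<in> residue_class L ` (?T \<inter> L)"
      using t(1) \<open>t \<in> L\<close> by blast
  qed
  then have "q \<le> card (?T \<inter> L)"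
    using fin surj_card_le[of "?T \<inter> L" "carrier (residue_field L)" "residue_class L"] R(2) by simp
  then have "?T \<inter> L = ?T"
    using card fin by (intro card_seteq) auto
  then show ?thesis
    using t by (auto simp: q_def)
qed

end

section \<open>Iterating the step\<close>

lemma rigid_functions_U_op:
  fixes P :: "nat \<Rightarrow> 'k::nonarch_field"
  assumes "nonarch_subfield K" "closed K" "Factorial_Ring.prime p"
    "absv (of_nat p :: 'k) = 1 / real p" "l \<ge> 1" "1 / real p < r ^ (p - 1)" "r < 1"
    "\<And>j. j \<in> {2..l} \<Longrightarrow> P j \<in> K" "\<And>j. j \<in> {2..l} \<Longrightarrow> absv (P j) \<le> 1"
  shows "U_op p ` rigid_functions K l P r s \<subseteq> rigid_functions K l P (r ^ p) (s * p)"
proof safe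
  fix \<xi>
  assume "\<xi> \<in> rigid_functions K l P r s"
  then obtain \<rho> c where \<rho>: "\<rho> \<in> K" "absv \<rho> = r" and c: "c \<in> tate_algebra K l"
    "\<And>x. x \<in> affinoid l P r s \<Longrightarrow>
      ((\<lambda>\<nu>. c \<nu> * coord_monomial l (affinoid_coord P \<rho> s x) \<nu>) has_sum \<xi> x) (multi_indices l)"
    unfolding rigid_functions_def coord_monomial_def by blast
  interpret U_op_step K p l s P \<rho>
    using assms \<rho> by (intro U_op_step.intro U_op_step_axioms.intro) auto
  show "U_op p \<xi> \<in> rigid_functions K l P (r ^ p) (s * p)"
    using U_op_mem_rigid_functions[OF c(1)] c(2) \<rho>(2) by auto
qed

text \<open>Raised to the power \<open>N = p ^ n * (p - 1)\<close>, the hypothesis reads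
  \<open>1 / p < r ^ N\<close>. For \<open>i \<le> n\<close> the exponent
  \<open>p ^ i * (p - 1)\<close> is at most \<open>N\<close>, which only helps when
  \<open>r < 1\<close>.\<close>

lemma power_gt_of_powr:
  fixes r :: real
  assumes "p > 1" "real p powr (- 1 / (real p ^ n * (real p - 1))) < r" "r > 0" "i \<le> n"
  shows "1 / real p < (r ^ p ^ i) ^ (p - 1)"
proof -
  define N where "N = p ^ n * (p - 1)"
  have N: "N > 0" "real N = real p ^ n * (real p - 1)"
    using assms(1) by (auto simp: N_def of_nat_diff)
  have "(real p powr (- 1 / real N)) ^ N < r ^ N"
    using assms(2) N by (intro power_strict_mono) auto
  moreover have "(real p powr (- 1 / real N)) ^ N = 1 / real p"
  proof -
    have "(real p powr (- 1 / real N)) ^ N = (real p powr (- 1 / real N)) powr real N"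
      using assms(1) by (simp add: powr_realpow)
    also have "\<dots> = real p powr (- 1)"
      unfolding powr_powr using N(1) by simp
    finally show ?thesis
      using assms(1) by (simp add: powr_minus_divide)
  qed
  ultimately have *: "1 / real p < r ^ N"
    by simp
  show ?thesis
  proof (cases "r < 1")
    case True
    have "p ^ i * (p - 1) \<le> N"
      unfolding N_def using assms by (intro mult_right_mono power_increasing) auto
    then have "r ^ N \<le> r ^ (p ^ i * (p - 1))"
      using True assms(3) by (intro power_decreasing) auto
    then show ?thesis
      using * by (simp add: power_mult)
  next
    case False
    then have "1 \<le> (r ^ p ^ i) ^ (p - 1)"
      by (intro one_le_power) auto
    moreover have "1 / real p < 1"
      using assms(1) by simp
    ultimately show ?thesis
      by linarith
  qed
qed

lemma rigid_functions_cong_centers: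
  assumes "\<And>j. j \<in> {2..l} \<Longrightarrow> P j ^ s = P j ^ s'"
  shows "rigid_functions K l P r s = rigid_functions K l P r s'"
proof -
  have "affinoid l P r s = affinoid l P r s'"
    using assms by (auto simp: affinoid_def)
  moreover have "(\<Prod>j\<in>{1..l}. affinoid_coord P \<rho> s x j ^ \<nu> j)
      = (\<Prod>j\<in>{1..l}. affinoid_coord P \<rho> s' x j ^ \<nu> j)" for \<rho> x \<nu>
    using assms by (intro prod.cong) (auto simp: affinoid_coord_def)
  ultimately show ?thesis
    by (simp add: rigid_functions_def)
qed

theorem theorem2p4:
  fixes p a l k :: nat and Qq \<Omega> :: "'k::nonarch_field set"
    and Pbar :: "nat \<Rightarrow> 'k set" and P :: "nat \<Rightarrow> 'k" and r :: real
  assumes "Factorial_Ring.prime p" and "is_Cp p TYPE('k)" and "a \<ge> 1" and "l \<ge> 1"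
    and "unramified_extension Qp Qq a"
    and "unramified_extension (Omega1 p) \<Omega> a"
    and "l \<ge> 2 \<Longrightarrow> P 2 = 0"
    and "\<And>j. j \<in> {3..l} \<Longrightarrow>
           Pbar j \<in> carrier (residue_field Qq) - {\<zero>\<^bsub>residue_field Qq\<^esub>}"
    and "inj_on Pbar {3..l}"
    and "\<And>j. j \<in> {3..l} \<Longrightarrow> teichmueller_lift (p ^ a) (Pbar j) (P j)"
    and "r \<in> absv ` (\<Omega> - {0})"
    and "real p powr (- 1 / (real p ^ (a - 1) * (real p - 1))) < r" and "r < 1"
  shows "U_op p ` rigid_functions \<Omega> l P r (p ^ k)
           \<subseteq> rigid_functions \<Omega> l P (r ^ p) (p ^ k * p) \<and>
         (U_op (p ^ a) :: ('k \<Rightarrow> 'k) \<Rightarrow> 'k \<Rightarrow> 'k) = U_op p ^^ a \<and>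
         U_op (p ^ a) ` rigid_functions \<Omega> l P r 1
           \<subseteq> rigid_functions \<Omega> l P (r ^ (p ^ a)) 1"
proof -
  note p = assms(1)
  have p1: "p > 1"
    using p by (rule prime_gt_1_nat)
  have absv_p: "absv (of_nat p :: 'k) = 1 / real p"
    using assms(2) by (simp add: is_Cp_def)
  have r: "r > 0"
    using assms(12) by (rule le_less_trans[rotated]) simp
  have \<Omega>: "nonarch_subfield \<Omega>" and dim: "ring.dimension field_ring a (Omega1 p) \<Omega>"
    using assms(6) by (auto simp: unramified_extension_def subfield_field_ring_iff)
  have closed: "closed \<Omega>"
    using closed_finite_dimension[OF nonarch_subfield_Omega1[OF p absv_p] closed_Omega1[OF p absv_p] dim] .
  have q: "p ^ a > 1"
    using p1 assms(3) one_less_power[of p a] by simp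
  \<comment> \<open>The centre \<open>0\<close> satisfies the same equation as the Teichmueller
    lifts, so all finite centres are treated alike.\<close>
  have fix_P: "P j ^ (p ^ a) = P j" if "j \<in> {2..l}" for j
  proof (cases "j = 2")
    case True
    then show ?thesis
      using assms(7) that p1 by (simp add: power_0_left)
  next
    case False
    then have "j \<in> {3..l}"
      using that by auto
    then show ?thesis
      using assms(10) by (simp add: teichmueller_lift_def)
  qed
  have P: "P j \<in> \<Omega>" "absv (P j) \<le> 1" if "j \<in> {2..l}" for j
    using fixed_points_mem_unramified[OF p absv_p assms(6,3) fix_P[OF that]]
      absv_fixed_power_le_1[OF fix_P[OF that] q] by auto
  \<comment> \<open>The radius at stage \<open>i\<close> is \<open>r ^ p ^ i\<close>; the lower
    bound on \<open>r\<close> is exactly what the last of the \<open>a\<close> stages,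
    \<open>i = a - 1\<close>, requires.\<close>
  have step: "U_op p ` rigid_functions \<Omega> l P (r ^ p ^ i) s
      \<subseteq> rigid_functions \<Omega> l P ((r ^ p ^ i) ^ p) (s * p)" if "i \<le> a - 1" for i s
    using p1 r assms(13) that
    by (intro rigid_functions_U_op[OF \<Omega> closed p absv_p assms(4)] P power_gt_of_powr[OF _ assms(12)])
      (auto intro!: power_less_one_iff[THEN iffD2])
  have power: "(U_op p ^^ i) ` rigid_functions \<Omega> l P r 1 \<subseteq> rigid_functions \<Omega> l P (r ^ p ^ i) (p ^ i)"
    if "i \<le> a" for i
    using that
  proof (induction i)
    case (Suc i)
    have "(U_op p ^^ Suc i) ` rigid_functions \<Omega> l P r 1
        \<subseteq> U_op p ` rigid_functions \<Omega> l P (r ^ p ^ i) (p ^ i)"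
      using Suc by (auto simp: image_comp[symmetric])
    also have "\<dots> \<subseteq> rigid_functions \<Omega> l P ((r ^ p ^ i) ^ p) (p ^ i * p)"
      using Suc.prems by (intro step) auto
    finally show ?case
      by (simp add: mult.commute flip: power_mult)
  qed simp
  have U: "(U_op (p ^ a) :: ('k \<Rightarrow> 'k) \<Rightarrow> 'k \<Rightarrow> 'k) = U_op p ^^ a"
    using p1 by (intro U_op_power) auto
  \<comment> \<open>After \<open>a\<close> steps the centres are \<open>P j ^ (p ^ a)\<close>, which
    are the original ones.\<close>
  have "rigid_functions \<Omega> l P (r ^ p ^ a) (p ^ a) = rigid_functions \<Omega> l P (r ^ p ^ a) 1"
    by (intro rigid_functions_cong_centers) (simp add: fix_P)
  then have "U_op (p ^ a) ` rigid_functions \<Omega> l P r 1 \<subseteq> rigid_functions \<Omega> l P (r ^ (p ^ a)) 1"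
    using power[of a] unfolding U by simp
  then show ?thesis
    using step[of 0 "p ^ k"] U by simp
qed

end
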